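(* Let $1/2<a\le b<1$ and let $H:[0,\infty)\to[a,b]$ be H\"older continuous with exponent $\alpha$ satisfying $1\ge\alpha>\sup_tH_t$. Let $X^H$ be a separable fractional Brownian motion with variable Hurst parameter $H$. Then, for each $t>0$, the local H\"older exponent of $X^H$ at $t$ is almost surely equal to $H_t$.
   Context: $\beta(\cdot,\cdot)$ denotes the Beta function, and for $h\in(1/2,1)$ set $c_h=\left(\frac{h(2h-1)}{\beta(2-2h,\,h-1/2)}\right)^{1/2}$. For measurable $H:[0,\infty)\to(1/2,1)$ write $H_t=H(t)$ and, for $s,t\ge0$, $$K_H(t,s)=\left[c_{H_t}s^{\frac12-H_t}\int_s^t(u-s)^{H_t-\frac32}u^{H_t-\frac12}\,du\right]\mathbf 1_{[0,t]}(s),\qquad R_H(t,s)=\int_0^{s\wedge t}K_H(t,u)K_H(s,u)\,du .$$ Fractional Brownian motion with variable Hurst parameter $H$ (fBMvH) is the centered Gaussian process $X^H=(X^H_t)_{t\ge0}$ starting at zero with covariance function $R_H$. A process is separable if (in the sense of Doob) there are a countable set $D\subset[0,\infty)$ and a null event $\Lambda$ such that for every closed set $A\subseteq\mathbb{R}$ and every open interval $I$, the events $\{X_t\in A\ \forall t\in I\cap D\}$ and $\{X_t\in A\ \forall t\in I\cap[0,\infty)\}$ differ only by a subset of $\Lambda$. A function $f$ has local H\"older exponent $\gamma$ at $t$ if $$\gamma=\sup\left\{\alpha:\ \lim_{h\to0}\frac{|f(t+h)-f(t)|}{|h|^\alpha}=0\right\}.$$ *)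

theory Defs
  imports "HOL-Probability.Probability"
begin

text \<open>Processes and functions of time in \<open>[0, \<infinity>)\<close> are modelled on the type \<^typ>\<open>real\<close>;
  their values at negative times are irrelevant.\<close>

definition c_hurst :: "real \<Rightarrow> real" where
  "c_hurst h = sqrt (h * (2 * h - 1) / Beta (2 - 2 * h) (h - 1 / 2))"

text \<open>At \<open>s = 0\<close> the factor \<open>s powr (1/2 - H t)\<close> is \<open>0\<close> by the convention of \<^term>\<open>(powr)\<close>;
  this concerns a single point and does not affect \<open>R_kernel\<close>.\<close>

definition K_kernel :: "(real \<Rightarrow> real) \<Rightarrow> real \<Rightarrow> real \<Rightarrow> real" where
  "K_kernel H t s =
     (c_hurst (H t) * s powr (1 / 2 - H t) *
       (LINT u:{s..t}|lborel. (u - s) powr (H t - 3 / 2) * u powr (H t - 1 / 2)))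
     * indicator {0..t} s"

definition R_kernel :: "(real \<Rightarrow> real) \<Rightarrow> real \<Rightarrow> real \<Rightarrow> real" where
  "R_kernel H t s = (LINT u:{0..min s t}|lborel. K_kernel H t u * K_kernel H s u)"

text \<open>Gaussian laws may be degenerate, hence the second disjunct.\<close>

definition gaussian_rv :: "'a measure \<Rightarrow> ('a \<Rightarrow> real) \<Rightarrow> bool" where
  "gaussian_rv M Y \<longleftrightarrow> Y \<in> borel_measurable M \<and>
     ((\<exists>\<mu> \<sigma>. 0 < \<sigma> \<and> distributed M lborel Y (normal_density \<mu> \<sigma>)) \<or>
      (\<exists>c. AE \<omega> in M. Y \<omega> = c))"

definition gaussian_process :: "'a measure \<Rightarrow> 'i set \<Rightarrow> ('i \<Rightarrow> 'a \<Rightarrow> real) \<Rightarrow> bool" where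
  "gaussian_process M T X \<longleftrightarrow>
     (\<forall>F c. finite F \<and> F \<subseteq> T \<longrightarrow> gaussian_rv M (\<lambda>\<omega>. \<Sum>t\<in>F. c t * X t \<omega>))"

definition covariance :: "'a measure \<Rightarrow> ('a \<Rightarrow> real) \<Rightarrow> ('a \<Rightarrow> real) \<Rightarrow> real" where
  "covariance M Y Z = (LINT \<omega>|M. (Y \<omega> - (LINT \<omega>|M. Y \<omega>)) * (Z \<omega> - (LINT \<omega>|M. Z \<omega>)))"

definition fBMvH :: "'a measure \<Rightarrow> (real \<Rightarrow> real) \<Rightarrow> (real \<Rightarrow> 'a \<Rightarrow> real) \<Rightarrow> bool" where
  "fBMvH M H X \<longleftrightarrow>
     prob_space M \<and>
     gaussian_process M {0..} X \<and>
     (\<forall>t\<ge>0. (LINT \<omega>|M. X t \<omega>) = 0) \<and>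
     (AE \<omega> in M. X 0 \<omega> = 0) \<and>
     (\<forall>t\<ge>0. \<forall>s\<ge>0. covariance M (X t) (X s) = R_kernel H t s)"

text \<open>Separability in the sense of Doob. The events need not be measurable for \<open>M\<close>; only the null
  event \<open>N\<close> is required to be.\<close>

definition separable_process :: "'a measure \<Rightarrow> (real \<Rightarrow> 'a \<Rightarrow> real) \<Rightarrow> bool" where
  "separable_process M X \<longleftrightarrow>
     (\<exists>D N. countable D \<and> D \<subseteq> {0..} \<and> N \<in> null_sets M \<and>
       (\<forall>A I. closed A \<and> open I \<and> is_interval I \<longrightarrow>
         (let E = {\<omega> \<in> space M. \<forall>t\<in>I \<inter> D. X t \<omega> \<in> A};
              E' = {\<omega> \<in> space M. \<forall>t\<in>I \<inter> {0..}. X t \<omega> \<in> A}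
          in (E - E') \<union> (E' - E) \<subseteq> N)))"

definition holder_continuous_on :: "real \<Rightarrow> real set \<Rightarrow> (real \<Rightarrow> real) \<Rightarrow> bool" where
  "holder_continuous_on \<alpha> T f \<longleftrightarrow>
     (\<exists>C. \<forall>s\<in>T. \<forall>t\<in>T. \<bar>f s - f t\<bar> \<le> C * \<bar>s - t\<bar> powr \<alpha>)"

text \<open>The supremum is taken in \<^typ>\<open>ereal\<close>, so that the unbounded and the empty case do not produce
  spurious real values.\<close>

definition local_holder_exponent :: "(real \<Rightarrow> real) \<Rightarrow> real \<Rightarrow> ereal" where
  "local_holder_exponent f t =
     Sup (ereal ` {\<alpha>. ((\<lambda>h. \<bar>f (t + h) - f t\<bar> / \<bar>h\<bar> powr \<alpha>) \<longlongrightarrow> 0) (at 0 within {h. 0 \<le> t + h})})"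

end

theory Submission
  imports Defs
begin

text \<open>
  Everything rests on two-sided bounds for the variance of an increment,
  \<open>E (X\<^sub>s - X\<^sub>r)\<^sup>2 = \<integral> (K(s,u) - K(r,u))\<^sup>2 du\<close>, where the time and the Hurst index both move between
  the two kernels. Pulling \<open>u powr (1/2 - h)\<close> into the inner integral gives
  \<open>K(t,u) = c\<^sub>h \<integral>\<^sub>u\<^sup>t g(v) powr x / (v - u) dv\<close> with \<open>x = h - 1/2\<close> and \<open>g(v) = (v - u) v / u\<close>; in this
  form the index enters only through a power of \<open>g\<close> and through the constant \<open>c\<^sub>h\<close>.

  \<^emph>\<open>Upper bound.\<close> A change of time contributes \<open>\<integral>\<^sub>r\<^sup>s (v - u) powr (x - 1) dv\<close>, which up to a constant is
  bounded by \<open>(r - u) powr (- q) * (s - r) powr (x + q)\<close> for every \<open>q < 1/2\<close>: giving up an arbitrarily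
  small part of the exponent leaves a square integrable singularity and avoids the exact Beta
  integrals. A change of the index contributes a term of order \<open>\<bar>H s - H r\<bar>\<close>, by the mean value theorem for \<open>x \<mapsto> g powr x\<close>.
  Hence \<open>E (X\<^sub>s - X\<^sub>r)\<^sup>2 \<le> V \<bar>s - r\<bar> powr (2 \<beta>)\<close> near \<open>t\<close> for each \<open>\<beta> < H t\<close>; the assumption that the
  exponent of \<open>H\<close> exceeds \<open>H t\<close> makes the second term harmless (\<open>K_kernel_increment_L2_upper\<close>,
  \<open>fBMvH_variance_upper\<close>).

  \<^emph>\<open>Lower bound.\<close> On \<open>{r..s}\<close> the kernel of \<open>X\<^sub>r\<close> vanishes, and what remains of \<open>K(s, \<cdot>)\<close> there already
  has squared norm at least \<open>c (s - r) powr (2 H s)\<close> (\<open>K_kernel_increment_L2_lower\<close>).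

  For \<open>\<gamma> < H t\<close> all Gaussian moments are controlled by the variance, so chaining along the grids
  \<open>t + \<delta> k / 2\<^sup>m\<close> (as in the Kolmogorov-Chentsov theorem, \<open>local_modulus_on_countable_set\<close>) bounds
  \<open>\<bar>X\<^sub>s - X\<^sub>t\<bar>\<close> for all \<open>s\<close> in the countable separating set; separability carries the bound over to all
  \<open>s\<close> near \<open>t\<close> (\<open>fBMvH_holder_below\<close>). For \<open>\<gamma> > H t\<close> the density of a Gaussian variable is at most
  of order \<open>1/\<sigma>\<close>, so that \<open>\<bar>X\<^sub>s - X\<^sub>t\<bar> \<le> \<bar>s - t\<bar> powr \<gamma>\<close> with \<open>s = t + 2\<^sup>-\<^sup>n\<close> has summable probabilities
  and almost surely fails for all large \<open>n\<close> (\<open>fBMvH_holder_above\<close>).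
\<close>

section \<open>Centred Gaussian variables\<close>

text \<open>The law of a centred Gaussian variable is determined by its variance. A degenerate one, being almost
  surely constant with mean zero, vanishes almost surely, and the formula holds for it with \<open>0 ^ 0 = 1\<close>.\<close>

lemma gaussian_rv_even_moments:
  assumes "prob_space M" and Y: "gaussian_rv M Y" and mean: "(LINT \<omega>|M. Y \<omega>) = 0"
  shows "integrable M (\<lambda>\<omega>. Y \<omega> ^ (2 * k))"
    and "(LINT \<omega>|M. Y \<omega> ^ (2 * k)) = fact (2 * k) / (2 ^ k * fact k) * (LINT \<omega>|M. (Y \<omega>)\<^sup>2) ^ k"
proof -
  interpret prob_space M by fact
  have [measurable]: "Y \<in> borel_measurable M" using Y by (simp add: gaussian_rv_def)
  have "integrable M (\<lambda>\<omega>. Y \<omega> ^ (2 * k)) \<and>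
    (LINT \<omega>|M. Y \<omega> ^ (2 * k)) = fact (2 * k) / (2 ^ k * fact k) * (LINT \<omega>|M. (Y \<omega>)\<^sup>2) ^ k"
    using Y unfolding gaussian_rv_def
  proof (elim conjE disjE exE)
    fix \<mu> \<sigma> :: real
    assume \<sigma>: "0 < \<sigma>" and D: "distributed M lborel Y (normal_density \<mu> \<sigma>)"
    have \<mu>: "\<mu> = 0" using normal_distributed_expectation[OF \<sigma> D] mean by simp
    have D0: "distributed M lborel Y (normal_density 0 \<sigma>)" using D \<mu> by simp
    have mom: "integrable M (\<lambda>\<omega>. Y \<omega> ^ (2 * j))"
      "(LINT \<omega>|M. Y \<omega> ^ (2 * j)) = fact (2 * j) / ((2 / \<sigma>\<^sup>2) ^ j * fact j)" for j
    proof -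
      have hb: "has_bochner_integral lborel (\<lambda>x. normal_density 0 \<sigma> x * x ^ (2 * j))
        (fact (2 * j) / ((2 / \<sigma>\<^sup>2) ^ j * fact j))"
        using normal_moment_even[OF \<sigma>, of 0 j] by simp
      show "integrable M (\<lambda>\<omega>. Y \<omega> ^ (2 * j))"
        using distributed_integrable[OF D0, of "\<lambda>x. x ^ (2 * j)"] hb
        by (auto simp: has_bochner_integral_iff)
      show "(LINT \<omega>|M. Y \<omega> ^ (2 * j)) = fact (2 * j) / ((2 / \<sigma>\<^sup>2) ^ j * fact j)"
        using distributed_integral[OF D0, of "\<lambda>x. x ^ (2 * j)"] hb
        by (auto simp: has_bochner_integral_iff)
    qed
    have v: "(LINT \<omega>|M. (Y \<omega>)\<^sup>2) = \<sigma>\<^sup>2" using mom(2)[of 1] by (simp add: fact_numeral)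
    show ?thesis using mom[of k] \<sigma> unfolding v by (simp add: power_divide field_simps)
  next
    fix c assume c: "AE \<omega> in M. Y \<omega> = c"
    have "(LINT \<omega>|M. Y \<omega>) = (LINT \<omega>|M. c)"
      by (intro integral_cong_AE) (use c in auto)
    then have "c = 0" using mean by (simp add: prob_space)
    with c have ae: "AE \<omega> in M. Y \<omega> = 0" by simp
    have ae': "AE \<omega> in M. Y \<omega> ^ (2 * j) = 0 ^ (2 * j)" for j using ae by eventually_elim simp
    have i: "integrable M (\<lambda>\<omega>. Y \<omega> ^ (2 * j)) \<longleftrightarrow> integrable M (\<lambda>\<omega>. (0::real) ^ (2 * j))" for j
      by (intro integrable_cong_AE) (use ae' in auto)
    have e: "(LINT \<omega>|M. Y \<omega> ^ (2 * j)) = (LINT \<omega>|M. 0 ^ (2 * j))" for j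
      by (intro integral_cong_AE) (use ae' in auto)
    show ?thesis using i[of k] e[of k] e[of 1] by (cases "k = 0") (auto simp: prob_space power_0_left)
  qed
  then show "integrable M (\<lambda>\<omega>. Y \<omega> ^ (2 * k))"
    and "(LINT \<omega>|M. Y \<omega> ^ (2 * k)) = fact (2 * k) / (2 ^ k * fact k) * (LINT \<omega>|M. (Y \<omega>)\<^sup>2) ^ k"
    by auto
qed

text \<open>Markov's inequality for the moment of order \<open>2 * k\<close>. The freedom in \<open>k\<close> lets chaining reach every
  exponent below that of the standard deviation: a large \<open>k\<close> beats the number of grid points.\<close>

lemma gaussian_rv_tail:
  assumes "prob_space M" and Y: "gaussian_rv M Y" and mean: "(LINT \<omega>|M. Y \<omega>) = 0"
    and var: "(LINT \<omega>|M. (Y \<omega>)\<^sup>2) \<le> v" and \<epsilon>: "0 < \<epsilon>"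
  shows "measure M {\<omega> \<in> space M. \<epsilon> < \<bar>Y \<omega>\<bar>} \<le> fact (2 * k) / (2 ^ k * fact k) * (v / \<epsilon>\<^sup>2) ^ k"
proof -
  interpret prob_space M by fact
  have [measurable]: "Y \<in> borel_measurable M" using Y by (simp add: gaussian_rv_def)
  have "measure M {\<omega> \<in> space M. \<epsilon> < \<bar>Y \<omega>\<bar>} \<le> measure M {\<omega> \<in> space M. \<epsilon> ^ (2 * k) \<le> Y \<omega> ^ (2 * k)}"
  proof (intro finite_measure_mono subsetI)
    fix \<omega> assume "\<omega> \<in> {\<omega> \<in> space M. \<epsilon> < \<bar>Y \<omega>\<bar>}"
    then show "\<omega> \<in> {\<omega> \<in> space M. \<epsilon> ^ (2 * k) \<le> Y \<omega> ^ (2 * k)}"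
      using power_mono[of \<epsilon> "\<bar>Y \<omega>\<bar>" "2 * k"] \<epsilon> by (simp add: power_mult)
  qed measurable
  also have "\<dots> \<le> (LINT \<omega>|M. Y \<omega> ^ (2 * k)) / \<epsilon> ^ (2 * k)"
    by (intro integral_Markov_inequality_measure[where A = "{}"] gaussian_rv_even_moments assms) (use \<epsilon> in auto)
  also have "\<dots> = fact (2 * k) / (2 ^ k * fact k) * ((LINT \<omega>|M. (Y \<omega>)\<^sup>2) / \<epsilon>\<^sup>2) ^ k"
    unfolding gaussian_rv_even_moments(2)[OF assms(1-3)] by (simp add: power_divide power_mult)
  also have "\<dots> \<le> fact (2 * k) / (2 ^ k * fact k) * (v / \<epsilon>\<^sup>2) ^ k"
    by (intro mult_left_mono power_mono divide_right_mono var) auto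
  finally show ?thesis .
qed

text \<open>The normal density never exceeds \<open>1 / (2 * \<sigma>)\<close>, since \<open>2 * pi \<ge> 4\<close>.\<close>

lemma gaussian_rv_small_ball:
  assumes "prob_space M" and Y: "gaussian_rv M Y" and mean: "(LINT \<omega>|M. Y \<omega>) = 0"
    and var: "v \<le> (LINT \<omega>|M. (Y \<omega>)\<^sup>2)" and v: "0 < v" and \<epsilon>: "0 \<le> \<epsilon>"
  shows "measure M {\<omega> \<in> space M. \<bar>Y \<omega>\<bar> \<le> \<epsilon>} \<le> \<epsilon> / sqrt v"
proof -
  interpret prob_space M by fact
  have [measurable]: "Y \<in> borel_measurable M" using Y by (simp add: gaussian_rv_def)
  show ?thesis using Y unfolding gaussian_rv_def
  proof (elim conjE disjE exE)
    fix \<mu> \<sigma> :: real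
    assume \<sigma>: "0 < \<sigma>" and D: "distributed M lborel Y (normal_density \<mu> \<sigma>)"
    have E: "expectation Y = \<mu>" using normal_distributed_expectation[OF \<sigma> D] .
    have \<mu>: "\<mu> = 0" using E mean by simp
    have "(LINT \<omega>|M. (Y \<omega>)\<^sup>2) = \<sigma>\<^sup>2"
      using normal_distributed_variance[OF \<sigma> D] E \<mu> by simp
    then have sv: "sqrt v \<le> \<sigma>" using var \<sigma> real_le_lsqrt by auto
    have dens: "normal_density 0 \<sigma> x \<le> 1 / (2 * \<sigma>)" for x
    proof -
      have "4 * \<sigma>\<^sup>2 \<le> 2 * pi * \<sigma>\<^sup>2" using pi_ge_two by (intro mult_right_mono) auto
      then have "2 * \<sigma> \<le> sqrt (2 * pi * \<sigma>\<^sup>2)"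
        using \<sigma> by (intro real_le_rsqrt) (simp add: power_mult_distrib)
      then have "1 / sqrt (2 * pi * \<sigma>\<^sup>2) * exp (- (x - 0)\<^sup>2 / (2 * \<sigma>\<^sup>2)) \<le> 1 / (2 * \<sigma>) * 1"
        using \<sigma> by (intro mult_mono divide_left_mono) auto
      then show ?thesis by (simp add: normal_density_def)
    qed
    have "emeasure M (Y -` {-\<epsilon>..\<epsilon>} \<inter> space M) =
        (\<integral>\<^sup>+x. ennreal (normal_density \<mu> \<sigma> x) * indicator {-\<epsilon>..\<epsilon>} x \<partial>lborel)"
      by (rule distributed_emeasure[OF D]) simp
    also have "\<dots> \<le> (\<integral>\<^sup>+x. ennreal (1 / (2 * \<sigma>)) * indicator {-\<epsilon>..\<epsilon>} x \<partial>lborel)"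
      using dens \<mu> by (intro nn_integral_mono mult_right_mono ennreal_leI) auto
    also have "\<dots> = ennreal (1 / (2 * \<sigma>)) * ennreal (2 * \<epsilon>)"
      using \<epsilon> by (subst nn_integral_cmult_indicator) auto
    also have "\<dots> = ennreal (\<epsilon> / \<sigma>)"
      using \<sigma> \<epsilon> by (subst ennreal_mult[symmetric]) auto
    finally have "emeasure M (Y -` {-\<epsilon>..\<epsilon>} \<inter> space M) \<le> ennreal (\<epsilon> / \<sigma>)" .
    moreover have "Y -` {-\<epsilon>..\<epsilon>} \<inter> space M = {\<omega> \<in> space M. \<bar>Y \<omega>\<bar> \<le> \<epsilon>}" by auto
    ultimately have "measure M {\<omega> \<in> space M. \<bar>Y \<omega>\<bar> \<le> \<epsilon>} \<le> \<epsilon> / \<sigma>"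
      using \<sigma> \<epsilon> by (simp add: emeasure_eq_measure)
    also have "\<dots> \<le> \<epsilon> / sqrt v" using sv v \<epsilon> \<sigma> by (intro divide_left_mono) auto
    finally show ?thesis .
  next
    fix c assume c: "AE \<omega> in M. Y \<omega> = c"
    have "(LINT \<omega>|M. Y \<omega>) = (LINT \<omega>|M. c)"
      by (intro integral_cong_AE) (use c in auto)
    then have "c = 0" using mean by (simp add: prob_space)
    have "(LINT \<omega>|M. (Y \<omega>)\<^sup>2) = (LINT \<omega>|M. 0)"
      by (intro integral_cong_AE) (use c \<open>c = 0\<close> in auto)
    then show ?thesis using var v by simp
  qed
qed

lemma gaussian_process_component:
  assumes "gaussian_process M T X" "t \<in> T"
  shows "gaussian_rv M (X t)"
  using assms(1)[unfolded gaussian_process_def, rule_format, of "{t}" "\<lambda>_. 1"] assms(2) by simp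

lemma centred_gaussian_process_increment:
  assumes "prob_space M" and X: "gaussian_process M T X"
    and mean: "\<And>t. t \<in> T \<Longrightarrow> (LINT \<omega>|M. X t \<omega>) = 0" and T: "s \<in> T" "r \<in> T"
  shows "gaussian_rv M (\<lambda>\<omega>. X s \<omega> - X r \<omega>)" (is ?g)
    and "(LINT \<omega>|M. X s \<omega> - X r \<omega>) = 0" (is ?m)
    and "(LINT \<omega>|M. (X s \<omega> - X r \<omega>)\<^sup>2) =
      covariance M (X s) (X s) - 2 * covariance M (X s) (X r) + covariance M (X r) (X r)" (is ?v)
proof -
  interpret prob_space M by fact
  have g: "gaussian_rv M (X q)" if "q \<in> T" for q
    using X that by (rule gaussian_process_component)
  have [measurable]: "X s \<in> borel_measurable M" "X r \<in> borel_measurable M"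
    using g T by (auto simp: gaussian_rv_def)
  have sq: "integrable M (\<lambda>\<omega>. (X q \<omega>)\<^sup>2)" if "q \<in> T" for q
    using gaussian_rv_even_moments(1)[OF assms(1) g[OF that] mean[OF that], of 1] by simp
  have i1: "integrable M (X s)" "integrable M (X r)"
    using sq[OF T(1)] sq[OF T(2)] by (auto intro: square_integrable_imp_integrable)
  have i2: "integrable M (\<lambda>\<omega>. X s \<omega> * X r \<omega>)"
  proof (rule Bochner_Integration.integrable_bound)
    show "integrable M (\<lambda>\<omega>. (X s \<omega>)\<^sup>2 + (X r \<omega>)\<^sup>2)" using sq T by auto
    have "\<bar>x * y\<bar> \<le> \<bar>x\<^sup>2 + y\<^sup>2\<bar>" for x y :: real
    proof -
      have "2 * \<bar>x * y\<bar> \<le> x\<^sup>2 + y\<^sup>2"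
        using sum_squares_bound[of "\<bar>x\<bar>" "\<bar>y\<bar>"] by (simp add: abs_mult)
      then show ?thesis by linarith
    qed
    then show "AE \<omega> in M. norm (X s \<omega> * X r \<omega>) \<le> norm ((X s \<omega>)\<^sup>2 + (X r \<omega>)\<^sup>2)" by simp
  qed measurable
  show ?m using i1 mean T by simp
  show ?v
  proof -
    have "(LINT \<omega>|M. (X s \<omega> - X r \<omega>)\<^sup>2)
      = (LINT \<omega>|M. (X s \<omega>)\<^sup>2 - 2 * (X s \<omega> * X r \<omega>) + (X r \<omega>)\<^sup>2)"
      by (intro Bochner_Integration.integral_cong) (auto simp: power2_diff)
    also have "\<dots> = (LINT \<omega>|M. (X s \<omega>)\<^sup>2) - 2 * (LINT \<omega>|M. X s \<omega> * X r \<omega>) + (LINT \<omega>|M. (X r \<omega>)\<^sup>2)"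
      using sq T i2 by simp
    finally show ?thesis using mean T by (simp add: covariance_def power2_eq_square)
  qed
  show ?g
  proof (cases "s = r")
    case True
    then show ?thesis by (auto simp: gaussian_rv_def)
  next
    case False
    then have "(\<lambda>\<omega>. \<Sum>q\<in>{s, r}. (if q = s then 1 else -1) * X q \<omega>) = (\<lambda>\<omega>. X s \<omega> - X r \<omega>)" by auto
    then show ?thesis
      using X[unfolded gaussian_process_def, rule_format, of "{s, r}" "\<lambda>q. if q = s then 1 else -1"] T
      by simp
  qed
qed

section \<open>Chaining on dyadic grids\<close>

text \<open>Write \<open>s\<^sub>m\<close> for the largest point of the grid of level \<open>m\<close> that is at most \<open>s\<close>. Then \<open>s\<^sub>m\<^sub>+\<^sub>1\<close> is \<open>s\<^sub>m\<close>
  or its right neighbour on the finer grid, and \<open>s\<^sub>n\<close> is \<open>t\<close> or its left neighbour, so \<open>f s - f t\<close>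
  telescopes into at most one step of each level \<open>m \<ge> n\<close>, and these sum to a geometric series.\<close>

lemma grid_chaining:
  fixes f :: "real \<Rightarrow> real" and t \<delta> \<rho> s :: real
  assumes \<delta>: "0 < \<delta>" and \<rho>: "0 < \<rho>" "\<rho> < 1"
    and step: "\<And>m k. N \<le> m \<Longrightarrow> k \<in> {- (2 ^ m) ..< 2 ^ m} \<Longrightarrow>
      \<bar>f (t + \<delta> * of_int (k + 1) / 2 ^ m) - f (t + \<delta> * of_int k / 2 ^ m)\<bar> \<le> \<rho> ^ m"
    and n: "N \<le> n" and s: "\<bar>s - t\<bar> < \<delta> / 2 ^ n"
    and lim: "(\<lambda>m. f (t + \<delta> * of_int \<lfloor>2 ^ m * ((s - t) / \<delta>)\<rfloor> / 2 ^ m)) \<longlonglongrightarrow> f s"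
  shows "\<bar>f s - f t\<bar> \<le> \<rho> ^ n / (1 - \<rho>)"
proof -
  define y where "y = (s - t) / \<delta>"
  define g where "g m = f (t + \<delta> * of_int \<lfloor>2 ^ m * y\<rfloor> / 2 ^ m)" for m :: nat
  have y: "\<bar>y\<bar> < 1 / 2 ^ n" using s \<delta> by (simp add: y_def abs_divide divide_simps mult.commute)
  have y1: "\<bar>y\<bar> < 1"
  proof -
    have "1 / 2 ^ n \<le> (1::real)" by simp
    with y show ?thesis by linarith
  qed
  have part: "\<bar>g (n + j) - f t\<bar> \<le> (\<Sum>i\<le>j. \<rho> ^ (n + i))" for j
  proof (induction j)
    case 0
    have "\<bar>2 ^ n * y\<bar> < 1" using y by (simp add: abs_mult field_simps)
    then have "\<lfloor>2 ^ n * y\<rfloor> = 0 \<or> \<lfloor>2 ^ n * y\<rfloor> = -1" by linarith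
    then show ?case
    proof
      assume "\<lfloor>2 ^ n * y\<rfloor> = 0"
      then show ?thesis using \<rho> by (simp add: g_def)
    next
      assume k: "\<lfloor>2 ^ n * y\<rfloor> = -1"
      have "(-1::int) < 2 ^ n" by (rule less_trans[of _ 0]) auto
      then show ?thesis using step[OF n, of "-1"] k by (simp add: g_def abs_minus_commute)
    qed
  next
    case (Suc j)
    define m where "m = n + j"
    define k where "k = \<lfloor>2 ^ m * y\<rfloor>"
    have "\<bar>2 ^ m * y\<bar> < 2 ^ m" using y1 by (simp add: abs_mult)
    then have "- (2 ^ m) < 2 ^ m * y" "2 ^ m * y < 2 ^ m" by linarith+
    then have k_range: "- (2 ^ m) \<le> k" "k < 2 ^ m" unfolding k_def
      by (simp_all add: le_floor_iff floor_less_iff)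
    have fl: "of_int k \<le> 2 ^ m * y" "2 ^ m * y < of_int k + 1" unfolding k_def by linarith+
    have "\<lfloor>2 ^ Suc m * y\<rfloor> = 2 * k \<or> \<lfloor>2 ^ Suc m * y\<rfloor> = 2 * k + 1"
    proof -
      have "2 ^ Suc m * y = 2 * (2 ^ m * y)" by simp
      then show ?thesis using fl by linarith
    qed
    moreover have gm: "g m = f (t + \<delta> * of_int (2 * k) / 2 ^ Suc m)" by (simp add: g_def k_def)
    moreover have "\<bar>f (t + \<delta> * of_int (2 * k + 1) / 2 ^ Suc m) - f (t + \<delta> * of_int (2 * k) / 2 ^ Suc m)\<bar> \<le> \<rho> ^ Suc m"
      by (rule step) (use k_range n in \<open>auto simp: m_def\<close>)
    ultimately have "\<bar>g (Suc m) - g m\<bar> \<le> \<rho> ^ Suc m"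
      using \<rho> unfolding g_def[of "Suc m"] by (elim disjE) auto
    then show ?case using Suc.IH by (simp add: m_def)
  qed
  have bound: "\<bar>g (n + j) - f t\<bar> \<le> \<rho> ^ n / (1 - \<rho>)" for j
  proof -
    have "(\<Sum>i\<le>j. \<rho> ^ (n + i)) = \<rho> ^ n * (\<Sum>i<Suc j. \<rho> ^ i)"
      by (simp add: power_add sum_distrib_left lessThan_Suc_atMost)
    also have "\<dots> \<le> \<rho> ^ n * (1 / (1 - \<rho>))"
    proof (intro mult_left_mono)
      have "(\<Sum>i<Suc j. \<rho> ^ i) = (1 - \<rho> ^ Suc j) / (1 - \<rho>)"
        using sum_gp_strict[of \<rho> "Suc j"] \<rho> by (simp del: sum.lessThan_Suc)
      also have "\<dots> \<le> 1 / (1 - \<rho>)" using \<rho> by (intro divide_right_mono) auto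
      finally show "(\<Sum>i<Suc j. \<rho> ^ i) \<le> 1 / (1 - \<rho>)" .
    qed (use \<rho> in auto)
    finally show ?thesis using part[of j] by simp
  qed
  have "(\<lambda>j. \<bar>g (n + j) - f t\<bar>) \<longlonglongrightarrow> \<bar>f s - f t\<bar>"
    using LIMSEQ_ignore_initial_segment[OF lim, of n] unfolding g_def y_def add.commute[of _ n]
    by (intro tendsto_intros)
  then show ?thesis using bound by (intro LIMSEQ_le_const2) auto
qed

text \<open>A version at a single point of the Kolmogorov-Chentsov theorem. Level \<open>m\<close> has \<open>2 * 2 ^ m\<close> steps, each longer than
  \<open>\<rho> ^ m\<close> with probability of order \<open>(2 powr (- \<beta>) / \<rho>) ^ (m * p)\<close>; the hypothesis on \<open>p\<close> makes the
  sum over all steps and levels finite. The countable set need not meet the grids: the same tail bound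
  shows that \<open>X\<close> at the grid approximations of a fixed \<open>s\<close> converges almost surely to \<open>X s\<close>.\<close>

lemma local_modulus_on_countable_set:
  fixes X :: "real \<Rightarrow> 'a \<Rightarrow> real"
  assumes "prob_space M" and meas: "\<And>s. s \<in> {t - \<delta>..t + \<delta>} \<Longrightarrow> X s \<in> borel_measurable M"
    and tail: "\<And>r s \<epsilon>. r \<in> {t - \<delta>..t + \<delta>} \<Longrightarrow> s \<in> {t - \<delta>..t + \<delta>} \<Longrightarrow> 0 < \<epsilon> \<Longrightarrow>
      measure M {\<omega> \<in> space M. \<epsilon> < \<bar>X s \<omega> - X r \<omega>\<bar>} \<le> C * (\<bar>s - r\<bar> powr \<beta> / \<epsilon>) ^ p"
    and \<delta>: "0 < \<delta>" and \<beta>: "0 < \<beta>" and C: "0 \<le> C" and \<rho>: "0 < \<rho>" "\<rho> < 1"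
    and p: "2 * (2 powr (- \<beta>) / \<rho>) ^ p < 1"
    and D: "countable D"
  shows "AE \<omega> in M. \<exists>N. \<forall>n\<ge>N. \<forall>s\<in>D. \<bar>s - t\<bar> < \<delta> / 2 ^ n \<longrightarrow> \<bar>X s \<omega> - X t \<omega>\<bar> \<le> \<rho> ^ n / (1 - \<rho>)"
proof -
  interpret prob_space M by fact
  define G where "G m k = t + \<delta> * of_int k / 2 ^ m" for m :: nat and k :: int
  define q where "q = (2 powr (- \<beta>) / \<rho>) ^ p"
  have q0: "0 \<le> q" using \<rho> by (simp add: q_def)
  have q1: "2 * q < 1" using p by (simp add: q_def)
  have G_in: "G m k \<in> {t - \<delta>..t + \<delta>}" if "- (2 ^ m) \<le> k" "k \<le> 2 ^ m" for m k
  proof -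
    have "- (2 ^ m) \<le> (of_int k :: real)" "of_int k \<le> (2 ^ m :: real)"
      using that of_int_le_iff[of "- (2 ^ m)" k, where ?'a = real] of_int_le_iff[of k "2 ^ m", where ?'a = real]
      by simp_all
    then have "\<delta> * (- (2 ^ m)) \<le> \<delta> * of_int k" "\<delta> * of_int k \<le> \<delta> * 2 ^ m"
      using \<delta> by (intro mult_left_mono; simp)+
    then show ?thesis by (simp add: G_def field_simps)
  qed
  have close: "measure M {\<omega> \<in> space M. \<rho> ^ m < \<bar>X s \<omega> - X r \<omega>\<bar>} \<le> C * (\<delta> powr \<beta>) ^ p * q ^ m"
    if "r \<in> {t - \<delta>..t + \<delta>}" "s \<in> {t - \<delta>..t + \<delta>}" "\<bar>s - r\<bar> \<le> \<delta> / 2 ^ m" for r s m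
  proof -
    have "\<bar>s - r\<bar> powr \<beta> \<le> (\<delta> / 2 ^ m) powr \<beta>" using that \<beta> by (intro powr_mono2) auto
    also have "\<dots> = \<delta> powr \<beta> * (2 powr (- \<beta>)) ^ m"
      using \<delta> by (simp add: powr_divide powr_minus divide_simps powr_realpow[symmetric] powr_powr mult.commute)
    finally have "\<bar>s - r\<bar> powr \<beta> / \<rho> ^ m \<le> \<delta> powr \<beta> * (2 powr (- \<beta>) / \<rho>) ^ m"
      using \<rho> by (simp add: power_divide divide_right_mono)
    then have "C * (\<bar>s - r\<bar> powr \<beta> / \<rho> ^ m) ^ p \<le> C * (\<delta> powr \<beta> * (2 powr (- \<beta>) / \<rho>) ^ m) ^ p"
      using C \<rho> by (intro mult_left_mono power_mono) auto
    also have "\<dots> = C * (\<delta> powr \<beta>) ^ p * q ^ m"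
      by (simp add: q_def power_mult_distrib power_mult[symmetric] mult.commute[of m p])
    finally show ?thesis using tail[OF that(1,2), of "\<rho> ^ m"] \<rho> by force
  qed
  define A where "A m k = {\<omega> \<in> space M. \<rho> ^ m < \<bar>X (G m (k + 1)) \<omega> - X (G m k) \<omega>\<bar>}" for m k
  have A_meas: "A m k \<in> events" if "k \<in> {- (2 ^ m)..<2 ^ m}" for m k
  proof -
    have [measurable]: "X (G m k) \<in> borel_measurable M" "X (G m (k + 1)) \<in> borel_measurable M"
      using that by (auto intro!: meas G_in)
    show ?thesis unfolding A_def by measurable
  qed
  define B where "B m = (\<Union>k\<in>{- (2 ^ m)..<2 ^ m}. A m k)" for m :: nat
  have B_meas: "B m \<in> events" for m unfolding B_def using A_meas by auto
  have "measure M (B m) \<le> 2 * C * (\<delta> powr \<beta>) ^ p * (2 * q) ^ m" for m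
  proof -
    have "measure M (B m) \<le> (\<Sum>k\<in>{- (2 ^ m)..<2 ^ m}. measure M (A m k))"
      unfolding B_def by (intro finite_measure_subadditive_finite) (use A_meas in auto)
    also have "\<dots> \<le> (\<Sum>k\<in>{- (2 ^ m)..<2 ^ m::int}. C * (\<delta> powr \<beta>) ^ p * q ^ m)"
      unfolding A_def
    proof (intro sum_mono close G_in)
      fix k assume "k \<in> {- (2 ^ m)..<2 ^ m::int}"
      show "\<bar>G m (k + 1) - G m k\<bar> \<le> \<delta> / 2 ^ m" using \<delta> by (simp add: G_def field_simps)
    qed auto
    also have "\<dots> = 2 * C * (\<delta> powr \<beta>) ^ p * (2 * q) ^ m"
      by (simp add: power_mult_distrib nat_add_distrib nat_power_eq)
    finally show ?thesis .
  qed
  then have "summable (\<lambda>m. measure M (B m))"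
    by (intro summable_comparison_test'[OF summable_mult[OF summable_geometric[of "2 * q"]], of 0])
       (use q0 q1 in auto)
  then have AE1: "AE \<omega> in M. \<forall>\<^sub>F m in sequentially. \<omega> \<in> space M - B m"
    by (intro borel_cantelli_AE1 B_meas) (auto simp: emeasure_eq_measure)
  define \<pi> where "\<pi> s m = G m \<lfloor>2 ^ m * ((s - t) / \<delta>)\<rfloor>" for s and m :: nat
  have AE2: "AE \<omega> in M. (\<lambda>m. X (\<pi> s m) \<omega>) \<longlonglongrightarrow> X s \<omega>" if s: "\<bar>s - t\<bar> < \<delta>" for s
  proof -
    have s_in: "s \<in> {t - \<delta>..t + \<delta>}" using s by auto
    define y where "y = (s - t) / \<delta>"
    have y1: "\<bar>y\<bar> < 1" using s \<delta> by (simp add: y_def abs_divide)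
    have sy: "s = t + \<delta> * y" using \<delta> by (simp add: y_def)
    have \<pi>_in: "\<pi> s m \<in> {t - \<delta>..t + \<delta>}" for m
    proof -
      have "\<bar>2 ^ m * y\<bar> < 2 ^ m" using y1 by (simp add: abs_mult)
      then have "- (2 ^ m) < 2 ^ m * y" "2 ^ m * y < 2 ^ m" by linarith+
      then have "- (2 ^ m) \<le> \<lfloor>2 ^ m * y\<rfloor>" "\<lfloor>2 ^ m * y\<rfloor> < 2 ^ m"
        by (simp_all add: le_floor_iff floor_less_iff)
      then show ?thesis unfolding \<pi>_def y_def[symmetric] by (intro G_in) auto
    qed
    have \<pi>_near: "\<bar>s - \<pi> s m\<bar> \<le> \<delta> / 2 ^ m" for m
    proof -
      have "s - \<pi> s m = \<delta> * (2 ^ m * y - of_int \<lfloor>2 ^ m * y\<rfloor>) / 2 ^ m"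
        unfolding \<pi>_def y_def[symmetric] by (simp add: G_def sy field_simps)
      moreover have "\<bar>2 ^ m * y - of_int \<lfloor>2 ^ m * y\<rfloor>\<bar> \<le> 1" by linarith
      then have "\<delta> * \<bar>2 ^ m * y - of_int \<lfloor>2 ^ m * y\<rfloor>\<bar> \<le> \<delta> * 1" using \<delta> by (intro mult_left_mono) auto
      ultimately show ?thesis using \<delta> by (simp add: abs_mult divide_right_mono)
    qed
    define E where "E m = {\<omega> \<in> space M. \<rho> ^ m < \<bar>X s \<omega> - X (\<pi> s m) \<omega>\<bar>}" for m
    have E_meas: "E m \<in> events" for m
    proof -
      have [measurable]: "X s \<in> borel_measurable M" "X (\<pi> s m) \<in> borel_measurable M"
        using \<pi>_in s_in by (auto intro!: meas)
      show ?thesis unfolding E_def by measurable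
    qed
    have "measure M (E m) \<le> C * (\<delta> powr \<beta>) ^ p * q ^ m" for m
      unfolding E_def by (intro close \<pi>_in s_in \<pi>_near)
    then have "summable (\<lambda>m. measure M (E m))"
      by (intro summable_comparison_test'[OF summable_mult[OF summable_geometric[of q]], of 0])
         (use q0 q1 in auto)
    then have "AE \<omega> in M. \<forall>\<^sub>F m in sequentially. \<omega> \<in> space M - E m"
      by (intro borel_cantelli_AE1 E_meas) (auto simp: emeasure_eq_measure)
    then show ?thesis
    proof eventually_elim
      case (elim \<omega>)
      have "(\<lambda>m. X (\<pi> s m) \<omega> - X s \<omega>) \<longlonglongrightarrow> 0"
      proof (rule Lim_null_comparison)
        show "\<forall>\<^sub>F m in sequentially. norm (X (\<pi> s m) \<omega> - X s \<omega>) \<le> \<rho> ^ m"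
          using elim by eventually_elim (auto simp: E_def abs_minus_commute)
        show "(\<lambda>m. \<rho> ^ m) \<longlonglongrightarrow> 0" using \<rho> by (intro LIMSEQ_realpow_zero) auto
      qed
      then show ?case by (rule LIM_zero_cancel)
    qed
  qed
  have "AE \<omega> in M. \<forall>s\<in>D. \<bar>s - t\<bar> < \<delta> \<longrightarrow> (\<lambda>m. X (\<pi> s m) \<omega>) \<longlonglongrightarrow> X s \<omega>"
    using AE2 D by (subst AE_ball_countable) auto
  with AE1 show ?thesis
  proof eventually_elim
    case (elim \<omega>)
    from elim(1) obtain N where N: "\<And>m. m \<ge> N \<Longrightarrow> \<omega> \<in> space M - B m"
      by (auto simp: eventually_sequentially)
    show ?case
    proof (intro exI[of _ N] allI impI ballI)
      fix n s assume n: "N \<le> n" and s: "s \<in> D" "\<bar>s - t\<bar> < \<delta> / 2 ^ n"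
      have "\<delta> / 2 ^ n \<le> \<delta> / 1" using \<delta> by (intro divide_left_mono) auto
      then have "\<bar>s - t\<bar> < \<delta>" using s by linarith
      then have "(\<lambda>m. X (\<pi> s m) \<omega>) \<longlonglongrightarrow> X s \<omega>" using elim(2) s by blast
      then show "\<bar>X s \<omega> - X t \<omega>\<bar> \<le> \<rho> ^ n / (1 - \<rho>)"
        unfolding \<pi>_def G_def
        by (intro grid_chaining[OF \<delta> \<rho> _ n s(2)])
           (use N in \<open>auto simp: B_def A_def G_def not_less\<close>)
    qed
  qed
qed

section \<open>Integral representation of the kernel\<close>

text \<open>Transfers a gauge integral, as the fundamental theorem of calculus yields it even at an integrable
  endpoint singularity, to the Lebesgue integral.\<close>

lemma set_integral_lborel_of_has_integral:
  fixes f :: "real \<Rightarrow> real"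
  assumes f [measurable]: "f \<in> borel_measurable borel" and S [measurable]: "S \<in> sets borel"
    and nonneg: "\<And>x. x \<in> S \<Longrightarrow> 0 \<le> f x" and I: "(f has_integral I) S"
  shows "set_integrable lborel S f" and "(LINT x:S|lborel. f x) = I"
proof -
  have "f absolutely_integrable_on S"
    using nonneg I by (intro nonnegative_absolutely_integrable_1) (auto simp: integrable_on_def)
  then show *: "set_integrable lborel S f"
    unfolding set_integrable_def by (subst (asm) integrable_completion) auto
  show "(LINT x:S|lborel. f x) = I"
    using set_borel_integral_eq_integral(2)[OF *] I by (simp add: integral_unique)
qed

lemma set_integral_powr_left:
  fixes x u r s :: real
  assumes "0 < x" "u \<le> r" "r \<le> s"
  shows "set_integrable lborel {r..s} (\<lambda>v. (v - u) powr (x - 1))"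
    and "(LINT v:{r..s}|lborel. (v - u) powr (x - 1)) = ((s - u) powr x - (r - u) powr x) / x"
proof -
  have "((\<lambda>v. (v - u) powr (x - 1)) has_integral ((s - u) powr x / x - (r - u) powr x / x)) {r..s}"
  proof (rule fundamental_theorem_of_calculus_interior[OF assms(3)])
    show "continuous_on {r..s} (\<lambda>v. (v - u) powr x / x)"
      using assms by (intro continuous_intros continuous_on_powr') auto
    fix v assume "v \<in> {r<..<s}"
    then show "((\<lambda>v. (v - u) powr x / x) has_vector_derivative (v - u) powr (x - 1)) (at v)"
      using assms unfolding has_real_derivative_iff_has_vector_derivative[symmetric]
      by (auto intro!: derivative_eq_intros)
  qed
  then show "set_integrable lborel {r..s} (\<lambda>v. (v - u) powr (x - 1))"
    and "(LINT v:{r..s}|lborel. (v - u) powr (x - 1)) = ((s - u) powr x - (r - u) powr x) / x"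
    by (auto intro!: set_integral_lborel_of_has_integral simp: diff_divide_distrib)
qed

lemma set_integral_powr_right:
  fixes x w r s :: real
  assumes "0 < x" "r \<le> s" "s \<le> w"
  shows "set_integrable lborel {r..s} (\<lambda>v. (w - v) powr (x - 1))"
    and "(LINT v:{r..s}|lborel. (w - v) powr (x - 1)) = ((w - r) powr x - (w - s) powr x) / x"
proof -
  have "((\<lambda>v. (w - v) powr (x - 1)) has_integral (- ((w - s) powr x) / x - (- ((w - r) powr x) / x))) {r..s}"
  proof (rule fundamental_theorem_of_calculus_interior[OF assms(2)])
    show "continuous_on {r..s} (\<lambda>v. - ((w - v) powr x) / x)"
      using assms by (intro continuous_intros continuous_on_powr') auto
    fix v assume "v \<in> {r<..<s}"
    then show "((\<lambda>v. - ((w - v) powr x) / x) has_vector_derivative (w - v) powr (x - 1)) (at v)"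
      using assms unfolding has_real_derivative_iff_has_vector_derivative[symmetric]
      by (auto intro!: derivative_eq_intros)
  qed
  then show "set_integrable lborel {r..s} (\<lambda>v. (w - v) powr (x - 1))"
    and "(LINT v:{r..s}|lborel. (w - v) powr (x - 1)) = ((w - r) powr x - (w - s) powr x) / x"
    by (auto intro!: set_integral_lborel_of_has_integral simp: diff_divide_distrib)
qed

text \<open>For \<open>0 < u < v\<close> this is \<open>q powr x / (v - u)\<close> with \<open>q = (v - u) * v / u\<close>, so that \<open>x\<close> occurs only as
  the exponent of \<open>q\<close>.\<close>

definition kernel_density :: "real \<Rightarrow> real \<Rightarrow> real \<Rightarrow> real" where
  "kernel_density x u v = (v - u) powr (x - 1) * (v / u) powr x"

definition J_kernel :: "real \<Rightarrow> real \<Rightarrow> real \<Rightarrow> real" where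
  "J_kernel x t u = (LINT v:{u..t}|lborel. kernel_density x u v)"

lemma kernel_density_nonneg: "0 \<le> kernel_density x u v"
  by (simp add: kernel_density_def)

lemma kernel_density_measurable [measurable]:
  "(\<lambda>p. kernel_density x (fst p) (snd p)) \<in> borel_measurable (borel \<Otimes>\<^sub>M borel)"
  unfolding kernel_density_def by measurable

lemma J_kernel_measurable [measurable]: "J_kernel x t \<in> borel_measurable borel"
proof -
  have "(\<lambda>p. (if fst p \<le> snd p \<and> snd p \<le> t then kernel_density x (fst p) (snd p) else 0))
     \<in> borel_measurable (borel \<Otimes>\<^sub>M lborel)"
    by measurable
  then have "(\<lambda>u. LINT v|lborel. (if u \<le> v \<and> v \<le> t then kernel_density x u v else 0)) \<in> borel_measurable borel"
    by (intro lborel.borel_measurable_lebesgue_integral) (simp add: case_prod_beta)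
  also have "(\<lambda>u. LINT v|lborel. (if u \<le> v \<and> v \<le> t then kernel_density x u v else 0)) = J_kernel x t"
    unfolding J_kernel_def set_lebesgue_integral_def
    by (intro ext Bochner_Integration.integral_cong) (auto simp: indicator_def)
  finally show ?thesis .
qed

text \<open>The factor \<open>u powr (1 / 2 - H t)\<close> is moved into the integral, where it turns \<open>v powr (H t - 1 / 2)\<close> into a
  power of \<open>v / u\<close>; beyond \<open>t\<close> both sides vanish.\<close>

lemma K_kernel_eq:
  assumes "0 < u"
  shows "K_kernel H t u = c_hurst (H t) * J_kernel (H t - 1 / 2) t u"
proof (cases "u \<le> t")
  case True
  have "kernel_density (H t - 1 / 2) u v = u powr (1 / 2 - H t) * ((v - u) powr (H t - 3 / 2) * v powr (H t - 1 / 2))"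
    if "u \<le> v" for v
  proof -
    have "u powr (1 / 2 - H t) = inverse (u powr (H t - 1 / 2))" by (simp add: powr_minus[symmetric])
    then show ?thesis using that assms by (simp add: kernel_density_def powr_divide field_simps)
  qed
  then have "J_kernel (H t - 1 / 2) t u = u powr (1 / 2 - H t) *
      (LINT v:{u..t}|lborel. (v - u) powr (H t - 3 / 2) * v powr (H t - 1 / 2))"
    unfolding J_kernel_def set_integral_mult_right[symmetric]
    by (intro set_lebesgue_integral_cong) auto
  then show ?thesis using True assms by (simp add: K_kernel_def)
next
  case False
  then show ?thesis by (simp add: K_kernel_def J_kernel_def set_lebesgue_integral_def)
qed

lemma K_kernel_measurable [measurable]: "K_kernel H t \<in> borel_measurable borel"
proof -
  have "K_kernel H t = (\<lambda>u. if 0 < u then c_hurst (H t) * J_kernel (H t - 1 / 2) t u else 0)"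
    by (rule ext) (auto simp: K_kernel_eq, auto simp: K_kernel_def indicator_def)
  then show ?thesis by simp
qed

text \<open>Replacing \<open>v\<close> by its upper bound leaves only the singularity at \<open>v = u\<close>, whose integral is elementary.\<close>

lemma kernel_density_le:
  assumes "0 \<le> x" "0 < u" "v \<le> s" "0 < v"
  shows "kernel_density x u v \<le> (s / u) powr x * (v - u) powr (x - 1)"
  unfolding kernel_density_def mult.commute[of "(v - u) powr _"]
  using assms by (intro mult_right_mono powr_mono2 divide_right_mono) auto

lemma kernel_density_integrable:
  assumes "0 < x" "0 < u"
  shows "set_integrable lborel {u..t} (kernel_density x u)"
proof (cases "u \<le> t")
  case True
  show ?thesis
  proof (rule set_integrable_bound)
    show "set_integrable lborel {u..t} (\<lambda>v. (t / u) powr x * (v - u) powr (x - 1))"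
      using set_integral_powr_left(1)[of x u u t] assms True by (intro set_integrable_mult_right) auto
    show "set_borel_measurable lborel {u..t} (kernel_density x u)"
      unfolding kernel_density_def set_borel_measurable_def by measurable
    show "AE v in lborel. v \<in> {u..t} \<longrightarrow>
        norm (kernel_density x u v) \<le> norm ((t / u) powr x * (v - u) powr (x - 1))"
      using kernel_density_le[of x u _ t] kernel_density_nonneg[of x u] assms by auto
  qed
qed (simp add: set_integrable_def)

lemma J_kernel_nonneg: "0 \<le> J_kernel x t u"
  unfolding J_kernel_def set_lebesgue_integral_def
  by (intro integral_nonneg_AE) (auto simp: kernel_density_nonneg)

lemma J_kernel_upper:
  assumes "0 < x" "0 < u" "u \<le> t"
  shows "J_kernel x t u \<le> (t / u) powr x * ((t - u) powr x / x)"
proof -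
  have "J_kernel x t u \<le> (LINT v:{u..t}|lborel. (t / u) powr x * (v - u) powr (x - 1))"
    unfolding J_kernel_def using assms
    by (intro set_integral_mono kernel_density_integrable set_integrable_mult_right
        set_integral_powr_left kernel_density_le) auto
  then show ?thesis using set_integral_powr_left(2)[of x u u t] assms by simp
qed

lemma J_kernel_lower:
  assumes "0 < x" "0 < u" "u \<le> t"
  shows "(t - u) powr x / x \<le> J_kernel x t u"
proof -
  have "(LINT v:{u..t}|lborel. (v - u) powr (x - 1)) \<le> J_kernel x t u"
    unfolding J_kernel_def
  proof (intro set_integral_mono kernel_density_integrable set_integral_powr_left assms)
    fix v assume "v \<in> {u..t}"
    then have "(v - u) powr (x - 1) * 1 \<le> kernel_density x u v"
      unfolding kernel_density_def using assms by (intro mult_left_mono ge_one_powr_ge_zero) auto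
    then show "(v - u) powr (x - 1) \<le> kernel_density x u v" by simp
  qed auto
  then show ?thesis using set_integral_powr_left(2)[of x u u t] assms by simp
qed

text \<open>The singularity \<open>u powr (- x)\<close> is absorbed into the common \<open>u powr (- B)\<close>, which does not vary with
  the Hurst index.\<close>

lemma J_kernel_upper_uniform:
  assumes "0 < x" "x \<le> B" "B \<le> 1 / 2" "0 < u" "t \<le> T" "1 \<le> T"
  shows "J_kernel x t u \<le> T\<^sup>2 / x * u powr (- B)"
proof (cases "u \<le> t")
  case True
  have "J_kernel x t u \<le> (t / u) powr x * ((t - u) powr x / x)"
    using assms True by (intro J_kernel_upper)
  also have "\<dots> \<le> (T / u) powr x * (T powr x / x)"
    using assms True by (intro mult_mono powr_mono2 divide_right_mono) auto
  also have "\<dots> = T powr (2 * x) * u powr (B - x) * u powr (- B) / x"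
  proof -
    have "u powr (B - x) * u powr (- B) = u powr (- x)" by (simp add: powr_add[symmetric])
    moreover have "T powr (2 * x) = T powr x * T powr x" by (simp add: powr_add[symmetric])
    ultimately show ?thesis using assms by (simp add: powr_divide powr_minus field_simps)
  qed
  also have "\<dots> \<le> T powr (2 * x) * T powr (B - x) * u powr (- B) / x"
    using assms True by (intro divide_right_mono mult_right_mono mult_left_mono powr_mono2) auto
  also have "T powr (2 * x) * T powr (B - x) = T powr (x + B)" by (simp add: powr_add[symmetric])
  also have "T powr (x + B) * u powr (- B) / x \<le> T powr 2 * u powr (- B) / x"
    using assms by (intro divide_right_mono mult_right_mono powr_mono) auto
  finally show ?thesis using assms by simp
next
  case False
  then have "J_kernel x t u = 0" by (simp add: J_kernel_def set_lebesgue_integral_def)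
  then show ?thesis using assms by simp
qed

text \<open>Splitting \<open>(v - u) powr (x - 1) = (v - u) powr (- q) * (v - u) powr (x + q - 1)\<close> and bounding
  \<open>v - u\<close> from below by \<open>r - u\<close> in the first factor and by \<open>v - r\<close> in the second trades a singularity
  at \<open>u = r\<close> for a power of \<open>s - r\<close>. For \<open>q < 1/2\<close> this singularity is square integrable.\<close>

lemma J_kernel_increment_in_time:
  assumes x: "0 < x" "x \<le> 1 / 2" and q: "0 \<le> q" "q \<le> 1 / 2" and u: "0 < u" "u < r" "r \<le> s"
  shows "\<bar>J_kernel x s u - J_kernel x r u\<bar> \<le> (s / u) powr x * (r - u) powr (- q) * ((s - r) powr (x + q) / (x + q))"
proof -
  have "J_kernel x s u = (LINT v:{u..r} \<union> {r<..s}|lborel. kernel_density x u v)"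
    unfolding J_kernel_def using u by (intro arg_cong2[where f = "set_lebesgue_integral lborel"]) auto
  also have "\<dots> = J_kernel x r u + (LINT v:{r<..s}|lborel. kernel_density x u v)"
    unfolding J_kernel_def using x u
    by (intro set_integral_Un kernel_density_integrable)
       (auto intro: set_integrable_subset[OF kernel_density_integrable[of x u s]])
  finally have eq: "J_kernel x s u - J_kernel x r u = (LINT v:{r<..s}|lborel. kernel_density x u v)" by simp
  have "(LINT v:{r<..s}|lborel. kernel_density x u v)
     \<le> (LINT v:{r..s}|lborel. (s / u) powr x * (r - u) powr (- q) * (v - r) powr (x + q - 1))"
    unfolding set_lebesgue_integral_def
  proof (rule integral_mono)
    show "integrable lborel (\<lambda>v. indicator {r<..s} v *\<^sub>R kernel_density x u v)"
      unfolding set_integrable_def[symmetric] using x u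
      by (auto intro: set_integrable_subset[OF kernel_density_integrable[of x u s]])
    show "integrable lborel
        (\<lambda>v. indicator {r..s} v *\<^sub>R ((s / u) powr x * (r - u) powr (- q) * (v - r) powr (x + q - 1)))"
      unfolding set_integrable_def[symmetric] using x q u set_integral_powr_left(1)[of "x + q" r r s]
      by (intro set_integrable_mult_right) auto
    fix v
    show "indicator {r<..s} v *\<^sub>R kernel_density x u v
      \<le> indicator {r..s} v *\<^sub>R ((s / u) powr x * (r - u) powr (- q) * (v - r) powr (x + q - 1))"
    proof (cases "v \<in> {r<..s}")
      case True
      have "(v - u) powr (x - 1) = (v - u) powr (- q) * (v - u) powr (x + q - 1)"
        by (simp add: powr_add[symmetric])
      also have "\<dots> \<le> (r - u) powr (- q) * (v - r) powr (x + q - 1)"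
        using True u x q by (intro mult_mono powr_mono2') auto
      finally have "(s / u) powr x * (v - u) powr (x - 1)
        \<le> (s / u) powr x * ((r - u) powr (- q) * (v - r) powr (x + q - 1))"
        by (intro mult_left_mono) auto
      with kernel_density_le[of x u v s] True x u
      have "kernel_density x u v \<le> (s / u) powr x * ((r - u) powr (- q) * (v - r) powr (x + q - 1))"
        by (intro order_trans[OF kernel_density_le[of x u v s]]) auto
      then show ?thesis using True by (simp add: mult.assoc)
    qed (auto simp: indicator_def)
  qed
  also have "\<dots> = (s / u) powr x * (r - u) powr (- q) * ((s - r) powr (x + q) / (x + q))"
    using set_integral_powr_left(2)[of "x + q" r r s] x q u by simp
  finally have "J_kernel x s u - J_kernel x r u \<le> \<dots>" unfolding eq .
  moreover have "0 \<le> J_kernel x s u - J_kernel x r u"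
    unfolding eq set_lebesgue_integral_def
    by (intro integral_nonneg_AE) (auto simp: kernel_density_nonneg)
  ultimately show ?thesis by simp
qed

lemma abs_ln_le_powr:
  fixes q \<epsilon> :: real
  assumes "0 < q" "0 < \<epsilon>"
  shows "\<bar>ln q\<bar> \<le> (q powr \<epsilon> + q powr (- \<epsilon>)) / \<epsilon>"
proof -
  have e: "q powr w = exp (w * ln q)" for w using assms by (simp add: powr_def)
  have "\<epsilon> * ln q \<le> q powr \<epsilon>"
    unfolding e using exp_ge_add_one_self[of "\<epsilon> * ln q"] by linarith
  moreover have "- (\<epsilon> * ln q) \<le> q powr (- \<epsilon>)"
    unfolding e using exp_ge_add_one_self[of "- \<epsilon> * ln q"] by simp
  moreover have "0 \<le> q powr \<epsilon>" "0 \<le> q powr (- \<epsilon>)" by simp_all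
  ultimately have "\<bar>\<epsilon> * ln q\<bar> \<le> q powr \<epsilon> + q powr (- \<epsilon>)" by linarith
  then show ?thesis using assms by (simp add: abs_mult field_simps)
qed

text \<open>Mean value theorem in the exponent; the factor \<open>ln q\<close> of the derivative costs an arbitrarily small
  power of \<open>q\<close>. The sum of the two extreme powers serves small and large \<open>q\<close> at once.\<close>

lemma powr_increment_in_exponent:
  fixes q x y A B \<epsilon> :: real
  assumes q: "0 < q" and \<epsilon>: "0 < \<epsilon>" and x: "x \<in> {A..B}" and y: "y \<in> {A..B}"
  shows "\<bar>q powr x - q powr y\<bar> \<le> 2 / \<epsilon> * \<bar>x - y\<bar> * (q powr (A - \<epsilon>) + q powr (B + \<epsilon>))"
proof -
  have between: "q powr w \<le> q powr (A - \<epsilon>) + q powr (B + \<epsilon>)" if "A - \<epsilon> \<le> w" "w \<le> B + \<epsilon>" for w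
  proof (cases "1 \<le> q")
    case True
    then have "q powr w \<le> q powr (B + \<epsilon>)" using that by (intro powr_mono)
    then show ?thesis by (simp add: add_increasing)
  next
    case False
    then have "q powr w \<le> q powr (A - \<epsilon>)" using that q by (intro powr_mono') auto
    then show ?thesis by (simp add: add_increasing2)
  qed
  define S where "S = q powr (A - \<epsilon>) + q powr (B + \<epsilon>)"
  have deriv: "\<bar>q powr z * ln q\<bar> \<le> 2 / \<epsilon> * S" if "z \<in> {A..B}" for z
  proof -
    have "\<bar>q powr z * ln q\<bar> \<le> q powr z * ((q powr \<epsilon> + q powr (- \<epsilon>)) / \<epsilon>)"
      unfolding abs_mult abs_of_nonneg[OF powr_ge_zero]
      by (intro mult_left_mono abs_ln_le_powr q \<epsilon>) auto
    also have "\<dots> = (q powr (z + \<epsilon>) + q powr (z - \<epsilon>)) / \<epsilon>"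
      by (simp add: powr_add powr_diff powr_minus field_simps)
    also have "\<dots> \<le> (S + S) / \<epsilon>"
      unfolding S_def using that \<epsilon> by (intro divide_right_mono add_mono between) auto
    finally show ?thesis by simp
  qed
  have "norm (q powr x - q powr y) \<le> (2 / \<epsilon> * S) * norm (x - y)"
  proof (rule field_differentiable_bound[of "{A..B}"])
    fix z assume "z \<in> {A..B}"
    then show "norm (q powr z * ln q) \<le> 2 / \<epsilon> * S" using deriv by simp
    show "((powr) q has_field_derivative q powr z * ln q) (at z within {A..B})"
    proof -
      have "(powr) q = (\<lambda>z. exp (z * ln q))" using q by (auto simp: powr_def fun_eq_iff)
      then show ?thesis by (auto intro!: derivative_eq_intros)
    qed
  qed (use x y in auto)
  then show ?thesis by (simp add: S_def algebra_simps)
qed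

text \<open>The previous estimate, divided by \<open>v - u\<close>, is an estimate between kernel densities and can be integrated.\<close>

lemma J_kernel_increment_in_exponent:
  assumes \<epsilon>: "0 < \<epsilon>" "\<epsilon> < A" and x: "x \<in> {A..B}" and y: "y \<in> {A..B}" and u: "0 < u"
  shows "\<bar>J_kernel x r u - J_kernel y r u\<bar>
    \<le> 2 / \<epsilon> * \<bar>x - y\<bar> * (J_kernel (A - \<epsilon>) r u + J_kernel (B + \<epsilon>) r u)"
proof -
  have int: "set_integrable lborel {u..r} (kernel_density w u)" if "0 < w" for w
    using kernel_density_integrable[OF that u] .
  have pos: "0 < x" "0 < y" "0 < A - \<epsilon>" "0 < B + \<epsilon>" using \<epsilon> x y by auto
  have "J_kernel x r u - J_kernel y r u = (LINT v:{u..r}|lborel. kernel_density x u v - kernel_density y u v)"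
    unfolding J_kernel_def using pos by (intro set_integral_diff(2)[symmetric] int)
  also have "\<bar>\<dots>\<bar> \<le> (LINT v:{u..r}|lborel. \<bar>kernel_density x u v - kernel_density y u v\<bar>)"
    using set_integral_norm_bound[of lborel "{u..r}" "\<lambda>v. kernel_density x u v - kernel_density y u v"]
      int pos by (auto intro: set_integral_diff)
  also have "\<dots> \<le> (LINT v:{u..r}|lborel.
      2 / \<epsilon> * \<bar>x - y\<bar> * (kernel_density (A - \<epsilon>) u v + kernel_density (B + \<epsilon>) u v))"
  proof (intro set_integral_mono)
    show "set_integrable lborel {u..r} (\<lambda>v. \<bar>kernel_density x u v - kernel_density y u v\<bar>)"
      using int pos by (intro set_integrable_abs set_integral_diff) auto
    show "set_integrable lborel {u..r}
       (\<lambda>v. 2 / \<epsilon> * \<bar>x - y\<bar> * (kernel_density (A - \<epsilon>) u v + kernel_density (B + \<epsilon>) u v))"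
      using int pos by (intro set_integrable_mult_right set_integral_add) auto
    fix v assume v: "v \<in> {u..r}"
    show "\<bar>kernel_density x u v - kernel_density y u v\<bar>
      \<le> 2 / \<epsilon> * \<bar>x - y\<bar> * (kernel_density (A - \<epsilon>) u v + kernel_density (B + \<epsilon>) u v)"
    proof (cases "v = u")
      case True
      then show ?thesis by (simp add: kernel_density_def)
    next
      case False
      with v u have vu: "u < v" by auto
      define q where "q = (v - u) * v / u"
      have q: "0 < q" using vu u by (simp add: q_def)
      have dens: "kernel_density w u v = q powr w / (v - u)" for w
        using vu u by (simp add: kernel_density_def q_def powr_mult powr_divide powr_diff)
      have "\<bar>kernel_density x u v - kernel_density y u v\<bar> = \<bar>q powr x - q powr y\<bar> / (v - u)"
        using vu unfolding dens by (simp add: diff_divide_distrib[symmetric] abs_divide)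
      also have "\<dots> \<le> 2 / \<epsilon> * \<bar>x - y\<bar> * (q powr (A - \<epsilon>) + q powr (B + \<epsilon>)) / (v - u)"
        using powr_increment_in_exponent[OF q \<epsilon>(1) x y] vu by (intro divide_right_mono) auto
      finally show ?thesis unfolding dens by (simp add: add_divide_distrib[symmetric])
    qed
  qed
  also have "\<dots> = 2 / \<epsilon> * \<bar>x - y\<bar> * (J_kernel (A - \<epsilon>) r u + J_kernel (B + \<epsilon>) r u)"
    unfolding J_kernel_def using set_integral_add(2)[OF int int, of "A - \<epsilon>" "B + \<epsilon>"] pos
    by simp
  finally show ?thesis .
qed

section \<open>The normalising constant\<close>

lemma pos_not_nonpos_Ints: "0 < (x::real) \<Longrightarrow> x \<notin> \<int>\<^sub>\<le>\<^sub>0"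
  by (auto elim!: nonpos_Ints_cases)

lemma Beta_pos: "0 < x \<Longrightarrow> 0 < y \<Longrightarrow> 0 < Beta x (y::real)"
  by (simp add: Beta_def Gamma_real_pos)

lemma c_hurst_pos:
  assumes "1 / 2 < h" "h < 1"
  shows "0 < c_hurst h"
  unfolding c_hurst_def using assms by (auto intro!: divide_pos_pos mult_pos_pos Beta_pos)

text \<open>The logarithmic derivative of \<open>c_hurst\<close>, with
  \<open>Beta (2 - 2 * h) (h - 1 / 2) = Gamma (2 - 2 * h) * Gamma (h - 1 / 2) / Gamma (3 / 2 - h)\<close>.\<close>

definition c_hurst_log_deriv :: "real \<Rightarrow> real" where
  "c_hurst_log_deriv h =
    (1 / h + 2 / (2 * h - 1) - Digamma (3 / 2 - h) + 2 * Digamma (2 - 2 * h) - Digamma (h - 1 / 2)) / 2"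

lemma has_field_derivative_c_hurst:
  assumes h: "1 / 2 < h" "h < 1"
  shows "(c_hurst has_field_derivative c_hurst h * c_hurst_log_deriv h) (at h within S)"
proof -
  define g where "g h = h * (2 * h - 1) * Gamma (3 / 2 - h) / (Gamma (2 - 2 * h) * Gamma (h - 1 / 2))" for h :: real
  have c: "c_hurst = (\<lambda>h. sqrt (g h))"
  proof
    fix h :: real
    have "Beta (2 - 2 * h) (h - 1 / 2) = Gamma (2 - 2 * h) * Gamma (h - 1 / 2) / Gamma (2 - 2 * h + (h - 1 / 2))"
      by (simp add: Beta_def)
    also have "2 - 2 * h + (h - 1 / 2) = 3 / 2 - h" by simp
    finally show "c_hurst h = sqrt (g h)" by (simp add: c_hurst_def g_def)
  qed
  have pos: "0 < Gamma (3 / 2 - h)" "0 < Gamma (2 - 2 * h)" "0 < Gamma (h - 1 / 2)"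
    using h by (auto intro!: Gamma_real_pos)
  have g: "0 < g h" using h pos by (simp add: g_def)
  have dg: "(g has_field_derivative g h * (2 * c_hurst_log_deriv h)) (at h within S)"
  proof -
    have mul: "((\<lambda>x. f x * k x) has_field_derivative f h * k h * (l + m)) (at h within S)"
      if "(f has_field_derivative f h * l) (at h within S)" "(k has_field_derivative k h * m) (at h within S)"
      for f k :: "real \<Rightarrow> real" and l m
      by (rule DERIV_cong[OF DERIV_mult[OF that]]) (simp add: algebra_simps)
    have quot: "((\<lambda>x. f x / k x) has_field_derivative f h / k h * (l - m)) (at h within S)"
      if "(f has_field_derivative f h * l) (at h within S)" "(k has_field_derivative k h * m) (at h within S)"
        "k h \<noteq> 0"
      for f k :: "real \<Rightarrow> real" and l m
      by (rule DERIV_cong[OF DERIV_divide[OF that]]) (use that(3) in \<open>simp add: field_simps\<close>)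
    have Gam: "((\<lambda>h. Gamma (f h)) has_field_derivative Gamma (f h) * (Digamma (f h) * d)) (at h within S)"
      if "(f has_field_derivative d) (at h within S)" "0 < f h" for f :: "real \<Rightarrow> real" and d
      using DERIV_chain2[where f = Gamma, OF has_field_derivative_Gamma that(1)] that(2)
      by (simp add: pos_not_nonpos_Ints mult.assoc)
    have dA: "((\<lambda>h. h * (2 * h - 1)) has_field_derivative h * (2 * h - 1) * (1 / h + 2 / (2 * h - 1))) (at h within S)"
      using h by (intro mul) (auto intro!: derivative_eq_intros simp: field_simps)
    have dB: "((\<lambda>h. Gamma (3 / 2 - h)) has_field_derivative
        Gamma (3 / 2 - h) * (Digamma (3 / 2 - h) * (-1))) (at h within S)"
      using h by (intro Gam) (auto intro!: derivative_eq_intros)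
    have dC: "((\<lambda>h. Gamma (2 - 2 * h)) has_field_derivative
        Gamma (2 - 2 * h) * (Digamma (2 - 2 * h) * (-2))) (at h within S)"
      using h by (intro Gam) (auto intro!: derivative_eq_intros)
    have dD: "((\<lambda>h. Gamma (h - 1 / 2)) has_field_derivative
        Gamma (h - 1 / 2) * (Digamma (h - 1 / 2) * 1)) (at h within S)"
      using h by (intro Gam) (auto intro!: derivative_eq_intros)
    have nz: "Gamma (2 - 2 * h) * Gamma (h - 1 / 2) \<noteq> 0"
      using mult_pos_pos[OF pos(2,3)] by linarith
    have "(g has_field_derivative g h * ((1 / h + 2 / (2 * h - 1)) + Digamma (3 / 2 - h) * (-1)
        - (Digamma (2 - 2 * h) * (-2) + Digamma (h - 1 / 2) * 1))) (at h within S)"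
      unfolding g_def by (rule quot[OF mul[OF dA dB] mul[OF dC dD] nz])
    also have "(1 / h + 2 / (2 * h - 1)) + Digamma (3 / 2 - h) * (-1)
        - (Digamma (2 - 2 * h) * (-2) + Digamma (h - 1 / 2) * 1) = 2 * c_hurst_log_deriv h"
      by (simp add: c_hurst_log_deriv_def)
    finally show ?thesis .
  qed
  show ?thesis
    unfolding c
  proof (rule DERIV_cong[OF DERIV_chain2[where f = sqrt, OF DERIV_real_sqrt[OF g] dg]])
    show "inverse (sqrt (g h)) / 2 * (g h * (2 * c_hurst_log_deriv h)) = sqrt (g h) * c_hurst_log_deriv h"
      using g real_sqrt_mult_self[of "g h"] by (simp add: field_simps)
  qed
qed

text \<open>On a compact subinterval of \<open>{1/2<..<1}\<close> the constant is positive and continuously differentiable.\<close>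

lemma c_hurst_bounds:
  assumes ab: "1 / 2 < a" "a \<le> b" "b < 1"
  obtains c0 C where "0 < c0" "0 < C"
    "\<And>h. h \<in> {a..b} \<Longrightarrow> c0 \<le> c_hurst h \<and> c_hurst h \<le> C"
    "\<And>h h'. h \<in> {a..b} \<Longrightarrow> h' \<in> {a..b} \<Longrightarrow> \<bar>c_hurst h - c_hurst h'\<bar> \<le> C * \<bar>h - h'\<bar>"
proof -
  have cont: "continuous_on {a..b} c_hurst"
    by (rule DERIV_continuous_on[OF has_field_derivative_c_hurst]) (use ab in auto)
  have contL: "continuous_on {a..b} c_hurst_log_deriv"
    unfolding c_hurst_log_deriv_def using ab
    by (intro continuous_intros continuous_on_compose2[OF continuous_on_Polygamma[of "{0<..}"]])
       (auto dest: pos_not_nonpos_Ints)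
  obtain h0 where h0: "h0 \<in> {a..b}" "\<And>h. h \<in> {a..b} \<Longrightarrow> c_hurst h0 \<le> c_hurst h"
    using continuous_attains_inf[OF compact_Icc _ cont] ab by force
  obtain h1 where h1: "h1 \<in> {a..b}" "\<And>h. h \<in> {a..b} \<Longrightarrow> c_hurst h \<le> c_hurst h1"
    using continuous_attains_sup[OF compact_Icc _ cont] ab by force
  have "continuous_on {a..b} (\<lambda>h. \<bar>c_hurst h * c_hurst_log_deriv h\<bar>)"
    by (intro continuous_intros cont contL)
  then obtain h2 where h2: "h2 \<in> {a..b}"
    "\<And>h. h \<in> {a..b} \<Longrightarrow> \<bar>c_hurst h * c_hurst_log_deriv h\<bar> \<le> \<bar>c_hurst h2 * c_hurst_log_deriv h2\<bar>"
    using continuous_attains_sup[OF compact_Icc, of a b] ab by force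
  define C where "C = max (c_hurst h1) \<bar>c_hurst h2 * c_hurst_log_deriv h2\<bar>"
  show ?thesis
  proof (rule that[of "c_hurst h0" C])
    show "0 < c_hurst h0" using h0 ab by (intro c_hurst_pos) auto
    have "0 < c_hurst h1" using h1 ab by (intro c_hurst_pos) auto
    then show "0 < C" by (simp add: C_def)
    show "c_hurst h0 \<le> c_hurst h \<and> c_hurst h \<le> C" if "h \<in> {a..b}" for h
      using h0(2)[OF that] h1(2)[OF that] by (simp add: C_def)
    fix h h' assume hh: "h \<in> {a..b}" "h' \<in> {a..b}"
    have "norm (c_hurst h - c_hurst h') \<le> C * norm (h - h')"
    proof (rule field_differentiable_bound[of "{a..b}"])
      fix z assume z: "z \<in> {a..b}"
      show "(c_hurst has_field_derivative c_hurst z * c_hurst_log_deriv z) (at z within {a..b})"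
        using z ab by (intro has_field_derivative_c_hurst) auto
      show "norm (c_hurst z * c_hurst_log_deriv z) \<le> C" using h2(2)[OF z] by (simp add: C_def)
    qed (use hh in auto)
    then show "\<bar>c_hurst h - c_hurst h'\<bar> \<le> C * \<bar>h - h'\<bar>" by simp
  qed
qed

section \<open>Increments of the kernel\<close>

text \<open>The exponent \<open>b / 2\<close> lies between \<open>b - 1 / 2\<close>, the worst singularity at \<open>u = 0\<close>, and \<open>1 / 2\<close>, below
  which \<open>u powr (- b / 2)\<close> is square integrable. It is the one used in all bounds that are uniform over \<open>{a..b}\<close>.\<close>

lemma K_kernel_pointwise_bound:
  assumes ab: "1 / 2 < a" "a \<le> b" "b < 1" and T: "1 \<le> T"
  obtains C where "0 \<le> C"
    "\<And>H t u. H t \<in> {a..b} \<Longrightarrow> t \<le> T \<Longrightarrow> 0 < u \<Longrightarrow> \<bar>K_kernel H t u\<bar> \<le> C * u powr (- b / 2)"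
proof -
  obtain c0 M where M: "0 < c0" "0 < M" "\<And>h. h \<in> {a..b} \<Longrightarrow> c0 \<le> c_hurst h \<and> c_hurst h \<le> M"
    by (rule c_hurst_bounds[OF ab]) blast
  define C where "C = M * (T\<^sup>2 / (a - 1 / 2))"
  show ?thesis
  proof (rule that[of C])
    show "0 \<le> C" using M ab by (simp add: C_def)
    fix H :: "real \<Rightarrow> real" and t u :: real assume H: "H t \<in> {a..b}" and t: "t \<le> T" and u: "0 < u"
    have "J_kernel (H t - 1 / 2) t u \<le> T\<^sup>2 / (H t - 1 / 2) * u powr - (b / 2)"
      using H t u T ab by (intro J_kernel_upper_uniform) auto
    also have "\<dots> \<le> T\<^sup>2 / (a - 1 / 2) * u powr - (b / 2)"
      using H ab by (intro mult_right_mono divide_left_mono) auto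
    finally have J: "J_kernel (H t - 1 / 2) t u \<le> T\<^sup>2 / (a - 1 / 2) * u powr - (b / 2)" .
    have c: "0 \<le> c_hurst (H t)" "c_hurst (H t) \<le> M" using M(1) M(3)[OF H] by auto
    have "\<bar>K_kernel H t u\<bar> = c_hurst (H t) * J_kernel (H t - 1 / 2) t u"
      using c J_kernel_nonneg by (simp add: K_kernel_eq[OF u])
    also have "\<dots> \<le> M * (T\<^sup>2 / (a - 1 / 2) * u powr - (b / 2))"
      using M(2) by (intro mult_mono c J J_kernel_nonneg) auto
    finally show "\<bar>K_kernel H t u\<bar> \<le> C * u powr (- b / 2)" by (simp add: C_def)
  qed
qed

lemma powr_power2: "(x powr y)\<^sup>2 = x powr (2 * y)" for x y :: real
  by (simp add: power2_eq_square powr_add[symmetric])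

lemma K_kernel_square_integrable:
  assumes ab: "1 / 2 < a" "a \<le> b" "b < 1" and H: "H t \<in> {a..b}" "H r \<in> {a..b}" and s: "0 \<le> s"
  shows "set_integrable lborel {0..s} (\<lambda>u. K_kernel H t u * K_kernel H r u)"
proof -
  define T where "T = max 1 (max t r)"
  obtain C where C: "0 \<le> C"
    "\<And>H t u. H t \<in> {a..b} \<Longrightarrow> t \<le> T \<Longrightarrow> 0 < u \<Longrightarrow> \<bar>K_kernel H t u\<bar> \<le> C * u powr (- b / 2)"
    using K_kernel_pointwise_bound[OF ab, of T] by (auto simp: T_def)
  show ?thesis
  proof (rule set_integrable_bound)
    show "set_integrable lborel {0..s} (\<lambda>u. C\<^sup>2 * (u - 0) powr (1 - b - 1))"
      using ab s by (intro set_integrable_mult_right set_integral_powr_left) auto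
    show "set_borel_measurable lborel {0..s} (\<lambda>u. K_kernel H t u * K_kernel H r u)"
      unfolding set_borel_measurable_def by measurable
    have "\<bar>K_kernel H t u * K_kernel H r u\<bar> \<le> C\<^sup>2 * u powr - b" if "0 < u" for u
    proof -
      have "\<bar>K_kernel H t u\<bar> * \<bar>K_kernel H r u\<bar> \<le> (C * u powr (- b / 2)) * (C * u powr (- b / 2))"
        using C(1) that by (intro mult_mono C(2) H) (auto simp: T_def)
      also have "\<dots> = C\<^sup>2 * u powr - b" using powr_power2[of u "- b / 2"] by (simp add: power2_eq_square)
      finally show ?thesis by (simp add: abs_mult)
    qed
    moreover have "K_kernel H t 0 = 0" by (simp add: K_kernel_def)
    ultimately have "\<bar>K_kernel H t u * K_kernel H r u\<bar> \<le> C\<^sup>2 * u powr - b" if "0 \<le> u" for u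
      using that by (cases "u = 0") auto
    then show "AE u in lborel. u \<in> {0..s} \<longrightarrow>
       norm (K_kernel H t u * K_kernel H r u) \<le> norm (C\<^sup>2 * (u - 0) powr (1 - b - 1))"
      by auto
  qed
qed

text \<open>Since \<open>K_kernel H r\<close> vanishes beyond \<open>r\<close>, all covariances are integrals over \<open>{0..s}\<close>.
  Square integrability of the kernels justifies expanding the square.\<close>

lemma R_kernel_increment:
  assumes ab: "1 / 2 < a" "a \<le> b" "b < 1" and H: "H s \<in> {a..b}" "H r \<in> {a..b}" and rs: "0 \<le> r" "r \<le> s"
  shows "set_integrable lborel {0..s} (\<lambda>u. (K_kernel H s u - K_kernel H r u)\<^sup>2)"
    and "R_kernel H s s - 2 * R_kernel H s r + R_kernel H r r =
      (LINT u:{0..s}|lborel. (K_kernel H s u - K_kernel H r u)\<^sup>2)"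
proof -
  note int = K_kernel_square_integrable[OF ab, where s = s]
  have cut: "(LINT u:{0..r}|lborel. K_kernel H w u * K_kernel H r u) =
    (LINT u:{0..s}|lborel. K_kernel H w u * K_kernel H r u)" for w
    unfolding set_lebesgue_integral_def using rs
    by (intro Bochner_Integration.integral_cong) (auto simp: indicator_def K_kernel_def)
  have sq: "(K_kernel H s u - K_kernel H r u)\<^sup>2 =
    K_kernel H s u * K_kernel H s u - 2 * (K_kernel H s u * K_kernel H r u) + K_kernel H r u * K_kernel H r u" for u
    by (simp add: power2_eq_square algebra_simps)
  have s0: "0 \<le> s" using rs by simp
  show "set_integrable lborel {0..s} (\<lambda>u. (K_kernel H s u - K_kernel H r u)\<^sup>2)"
    unfolding sq using H s0 by (intro set_integral_add set_integral_diff set_integrable_mult_right int)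
  have "R_kernel H s s - 2 * R_kernel H s r + R_kernel H r r =
      (LINT u:{0..s}|lborel. K_kernel H s u * K_kernel H s u)
      - (LINT u:{0..s}|lborel. 2 * (K_kernel H s u * K_kernel H r u))
      + (LINT u:{0..s}|lborel. K_kernel H r u * K_kernel H r u)"
    using rs by (simp add: R_kernel_def cut min_def)
  also have "\<dots> = (LINT u:{0..s}|lborel. (K_kernel H s u - K_kernel H r u)\<^sup>2)"
  proof -
    note i = int[where H = H and t = s and r = s, OF H(1) H(1) s0]
      set_integrable_mult_right[of 2, OF int[where H = H and t = s and r = r, OF H(1) H(2) s0]]
      int[where H = H and t = r and r = r, OF H(2) H(2) s0]
    show ?thesis
      unfolding sq set_integral_add(2)[OF set_integral_diff(1)[OF i(1,2)] i(3)] set_integral_diff(2)[OF i(1,2)] ..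
  qed
  finally show "R_kernel H s s - 2 * R_kernel H s r + R_kernel H r r =
      (LINT u:{0..s}|lborel. (K_kernel H s u - K_kernel H r u)\<^sup>2)" .
qed

text \<open>The difference is decomposed into a change of time at fixed index, a change of index in the integral,
  and a change of index in the constant. All three are dominated by the product of the singularities \<open>u powr (- b / 2)\<close> at the
  origin and \<open>(r - u) powr (- q)\<close> at \<open>r\<close>.\<close>

lemma K_kernel_increment_bound:
  assumes ab: "1 / 2 < a" "a \<le> b" "b < 1" and T: "1 \<le> T" and q: "0 \<le> q" "q \<le> 1 / 2"
  obtains C where "0 \<le> C"
    "\<And>H r s u. H s \<in> {a..b} \<Longrightarrow> H r \<in> {a..b} \<Longrightarrow> 0 < u \<Longrightarrow> u < r \<Longrightarrow> r \<le> s \<Longrightarrow> s \<le> T \<Longrightarrow>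
      \<bar>K_kernel H s u - K_kernel H r u\<bar>
      \<le> C * ((s - r) powr (H s - 1 / 2 + q) + \<bar>H s - H r\<bar>) * (u powr (- b / 2) * (r - u) powr (- q))"
proof -
  obtain c0 M where M: "0 < c0" "0 < M" "\<And>h. h \<in> {a..b} \<Longrightarrow> c0 \<le> c_hurst h \<and> c_hurst h \<le> M"
    and L: "\<And>h h'. h \<in> {a..b} \<Longrightarrow> h' \<in> {a..b} \<Longrightarrow> \<bar>c_hurst h - c_hurst h'\<bar> \<le> M * \<bar>h - h'\<bar>"
    by (rule c_hurst_bounds[OF ab]) blast
  define A where "A = a - 1 / 2"
  define B where "B = b - 1 / 2"
  \<comment> \<open>The enlarged range \<open>{A - \<epsilon>..B + \<epsilon>}\<close> of exponents stays positive and below \<open>b / 2\<close>.\<close>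
  define \<epsilon> where "\<epsilon> = min (A / 2) ((1 - b) / 2)"
  have A: "0 < A" and \<epsilon>: "0 < \<epsilon>" "\<epsilon> < A" "\<epsilon> \<le> A / 2" "B + \<epsilon> \<le> b / 2" and B: "A \<le> B"
  proof -
    have "0 < \<epsilon>" using ab by (simp add: \<epsilon>_def A_def)
    moreover have "\<epsilon> \<le> A / 2" "\<epsilon> \<le> (1 - b) / 2" unfolding \<epsilon>_def by (rule min.cobounded1 min.cobounded2)+
    ultimately show "0 < A" "0 < \<epsilon>" "\<epsilon> < A" "\<epsilon> \<le> A / 2" "B + \<epsilon> \<le> b / 2" "A \<le> B"
      using ab by (simp_all add: A_def B_def field_simps)
  qed
  define C1 where "C1 = M * T / A"
  define C2 where "C2 = M * (2 / \<epsilon>) * (4 * T\<^sup>2 / A) + M * (T\<^sup>2 / A)"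
  have C12: "0 \<le> C1" "0 \<le> C2" using M A \<epsilon> T by (auto simp: C1_def C2_def)
  show ?thesis
  proof (rule that[of "C1 + C2 * T"])
    show "0 \<le> C1 + C2 * T" using C12 T by simp
    fix H :: "real \<Rightarrow> real" and r s u :: real
    assume H: "H s \<in> {a..b}" "H r \<in> {a..b}" and u: "0 < u" "u < r" and rs: "r \<le> s" "s \<le> T"
    define x where "x = H s - 1 / 2"
    define y where "y = H r - 1 / 2"
    have xy: "x \<in> {A..B}" "y \<in> {A..B}" using H by (auto simp: x_def y_def A_def B_def)
    have x12: "0 < x" "x \<le> 1 / 2" "x \<le> b / 2" "A \<le> x" using xy A ab by (auto simp: B_def)
    have cs: "0 \<le> c_hurst (H s)" "c_hurst (H s) \<le> M" using M(1) M(3)[OF H(1)] by auto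
    have "(s / u) powr x = s powr x * (u powr (b / 2 - x) * u powr (- b / 2))"
    proof -
      have "u powr (b / 2 - x) * u powr (- b / 2) = u powr (- x)" by (simp add: powr_add[symmetric])
      moreover have "(s / u) powr x = s powr x * u powr (- x)"
        using u rs by (simp add: powr_divide powr_minus_divide)
      ultimately show ?thesis by simp
    qed
    also have "\<dots> \<le> T powr x * (T powr (b / 2 - x) * u powr (- b / 2))"
      using u rs x12 by (intro mult_mono[OF powr_mono2 mult_right_mono[OF powr_mono2]]) auto
    also have "\<dots> = T powr (b / 2) * u powr (- b / 2)" by (simp add: powr_add[symmetric])
    also have "\<dots> \<le> T powr 1 * u powr (- b / 2)" using T ab by (intro mult_right_mono powr_mono) auto
    finally have su: "(s / u) powr x \<le> T * u powr (- b / 2)" using T by simp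
    define \<Delta> where "\<Delta> = (s - r) powr (H s - 1 / 2 + q)"
    define W where "W = u powr (- b / 2) * (r - u) powr (- q)"
    have \<Delta>0: "0 \<le> \<Delta>" and W0: "0 \<le> W" by (auto simp: \<Delta>_def W_def)
    have t1: "c_hurst (H s) * \<bar>J_kernel x s u - J_kernel x r u\<bar> \<le> C1 * \<Delta> * W"
    proof -
      have "\<bar>J_kernel x s u - J_kernel x r u\<bar> \<le> (s / u) powr x * (r - u) powr (- q) * ((s - r) powr (x + q) / (x + q))"
        using x12 q u rs by (intro J_kernel_increment_in_time)
      also have "\<dots> \<le> (T * u powr (- b / 2)) * (r - u) powr (- q) * ((s - r) powr (x + q) / A)"
        using A x12 q T by (intro mult_mono su divide_left_mono mult_pos_pos) auto
      finally have "c_hurst (H s) * \<bar>J_kernel x s u - J_kernel x r u\<bar>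
        \<le> M * ((T * u powr (- b / 2)) * (r - u) powr (- q) * ((s - r) powr (x + q) / A))"
        using cs M(2) by (intro mult_mono) auto
      also have "\<dots> = C1 * \<Delta> * W" by (simp add: C1_def \<Delta>_def W_def x_def)
      finally show ?thesis .
    qed
    have Jle: "J_kernel w r u \<le> 2 * T\<^sup>2 / A * u powr (- b / 2)" if "A / 2 \<le> w" "w \<le> b / 2" for w
    proof -
      have "J_kernel w r u \<le> T\<^sup>2 / w * u powr - (b / 2)"
        using that A ab u rs T by (intro J_kernel_upper_uniform) auto
      also have "\<dots> \<le> T\<^sup>2 / (A / 2) * u powr - (b / 2)"
        using that A by (intro mult_right_mono divide_left_mono) auto
      finally show ?thesis by (simp add: mult_ac)
    qed
    have Jy: "J_kernel y r u \<le> T\<^sup>2 / A * u powr (- b / 2)"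
    proof -
      have "J_kernel y r u \<le> T\<^sup>2 / y * u powr - (b / 2)"
        using xy A ab u rs T by (intro J_kernel_upper_uniform) (auto simp: B_def)
      also have "\<dots> \<le> T\<^sup>2 / A * u powr - (b / 2)"
        using xy A by (intro mult_right_mono divide_left_mono) auto
      finally show ?thesis by simp
    qed
    have xyH: "\<bar>x - y\<bar> = \<bar>H s - H r\<bar>" by (simp add: x_def y_def)
    have t2: "c_hurst (H s) * \<bar>J_kernel x r u - J_kernel y r u\<bar>
      \<le> M * (2 / \<epsilon>) * (4 * T\<^sup>2 / A) * \<bar>H s - H r\<bar> * u powr (- b / 2)"
    proof -
      have "\<bar>J_kernel x r u - J_kernel y r u\<bar>
        \<le> 2 / \<epsilon> * \<bar>x - y\<bar> * (J_kernel (A - \<epsilon>) r u + J_kernel (B + \<epsilon>) r u)"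
        using \<epsilon> xy u by (intro J_kernel_increment_in_exponent)
      also have "\<dots> \<le> 2 / \<epsilon> * \<bar>x - y\<bar> * (2 * T\<^sup>2 / A * u powr (- b / 2) + 2 * T\<^sup>2 / A * u powr (- b / 2))"
        using \<epsilon> A B ab by (intro mult_left_mono add_mono Jle) (auto simp: B_def)
      finally have "c_hurst (H s) * \<bar>J_kernel x r u - J_kernel y r u\<bar>
        \<le> M * (2 / \<epsilon> * \<bar>x - y\<bar> * (2 * T\<^sup>2 / A * u powr (- b / 2) + 2 * T\<^sup>2 / A * u powr (- b / 2)))"
        using cs M(2) by (intro mult_mono) auto
      then show ?thesis unfolding xyH by (simp add: field_simps)
    qed
    have t3: "\<bar>c_hurst (H s) - c_hurst (H r)\<bar> * J_kernel y r u \<le> M * (T\<^sup>2 / A) * \<bar>H s - H r\<bar> * u powr (- b / 2)"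
    proof -
      have "\<bar>c_hurst (H s) - c_hurst (H r)\<bar> * J_kernel y r u \<le> (M * \<bar>H s - H r\<bar>) * (T\<^sup>2 / A * u powr (- b / 2))"
        using M(2) by (intro mult_mono L H Jy J_kernel_nonneg) auto
      then show ?thesis by (simp add: mult_ac)
    qed
    have "u powr (- b / 2) = u powr (- b / 2) * (r - u) powr q * (r - u) powr (- q)"
      using u by (simp add: powr_minus)
    also have "(r - u) powr q \<le> T"
    proof -
      have "(r - u) powr q \<le> T powr q" using u rs q by (intro powr_mono2) auto
      also have "\<dots> \<le> T powr 1" using T q by (intro powr_mono) auto
      finally show ?thesis using T by simp
    qed
    then have "u powr (- b / 2) * (r - u) powr q * (r - u) powr (- q) \<le> u powr (- b / 2) * T * (r - u) powr (- q)"
      by (intro mult_right_mono mult_left_mono) auto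
    finally have uW: "u powr (- b / 2) \<le> T * W" by (simp add: W_def mult_ac)
    have "K_kernel H s u - K_kernel H r u = c_hurst (H s) * (J_kernel x s u - J_kernel x r u)
      + c_hurst (H s) * (J_kernel x r u - J_kernel y r u) + (c_hurst (H s) - c_hurst (H r)) * J_kernel y r u"
      using u by (simp add: K_kernel_eq x_def y_def algebra_simps)
    also have "\<bar>\<dots>\<bar> \<le> c_hurst (H s) * \<bar>J_kernel x s u - J_kernel x r u\<bar>
      + c_hurst (H s) * \<bar>J_kernel x r u - J_kernel y r u\<bar> + \<bar>c_hurst (H s) - c_hurst (H r)\<bar> * J_kernel y r u"
      using cs J_kernel_nonneg[of y r u] abs_triangle_ineq4 by (intro order_trans[OF abs_triangle_ineq] add_mono) (auto simp: abs_mult)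
    also have "\<dots> \<le> C1 * \<Delta> * W + C2 * \<bar>H s - H r\<bar> * u powr (- b / 2)"
      using t1 t2 t3 by (simp add: C2_def algebra_simps)
    also have "\<dots> \<le> C1 * \<Delta> * W + C2 * \<bar>H s - H r\<bar> * (T * W)"
      using C12 uW by (intro add_left_mono mult_left_mono) auto
    also have "\<dots> \<le> (C1 + C2 * T) * (\<Delta> + \<bar>H s - H r\<bar>) * W"
      using C12 T \<Delta>0 W0 by (simp add: algebra_simps)
    finally show "\<bar>K_kernel H s u - K_kernel H r u\<bar>
      \<le> (C1 + C2 * T) * ((s - r) powr (H s - 1 / 2 + q) + \<bar>H s - H r\<bar>) * (u powr (- b / 2) * (r - u) powr (- q))"
      unfolding \<Delta>_def W_def .
  qed
qed

section \<open>Square integrals of kernel increments\<close>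

text \<open>The points \<open>0\<close> and \<open>r\<close> are at distance at least \<open>2 * \<tau>\<close>, so at most one of the two factors is large.\<close>

lemma powr_product_singularity:
  fixes u r \<tau> p q :: real
  assumes "0 < \<tau>" "2 * \<tau> \<le> r" "0 < u" "u < r" "0 \<le> p" "0 \<le> q"
  shows "u powr (- p) * (r - u) powr (- q) \<le> \<tau> powr (- q) * u powr (- p) + \<tau> powr (- p) * (r - u) powr (- q)"
proof (cases "\<tau> \<le> u")
  case True
  then have "u powr (- p) * (r - u) powr (- q) \<le> \<tau> powr (- p) * (r - u) powr (- q)"
    using assms by (intro mult_right_mono powr_mono2') auto
  then show ?thesis by (simp add: add_increasing)
next
  case False
  then have "u powr (- p) * (r - u) powr (- q) \<le> u powr (- p) * \<tau> powr (- q)"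
    using assms by (intro mult_left_mono powr_mono2') auto
  then show ?thesis by (simp add: add_increasing2 mult.commute)
qed

lemma K_kernel_eq_0:
  assumes "1 / 2 < H t" "0 < t" "t \<le> u"
  shows "K_kernel H t u = 0"
proof (cases "u = t")
  case True
  then show ?thesis
    using J_kernel_upper[of "H t - 1 / 2" t t] J_kernel_nonneg[of "H t - 1 / 2" t t] assms
    by (simp add: K_kernel_eq)
qed (use assms in \<open>simp add: K_kernel_def\<close>)

text \<open>On \<open>{0..r}\<close> the pointwise bound on the increment is squared and integrated. On \<open>{r..s}\<close> only \<open>K_kernel H s\<close>
  survives; it is of order \<open>(s - r) powr x\<close> on an interval of length \<open>s - r\<close>. Staying away from time
  \<open>0\<close> by \<open>t0\<close> keeps the factor \<open>(s / u) powr x\<close> bounded there and the two singularities on \<open>{0..r}\<close> apart.\<close>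

lemma K_kernel_increment_L2_upper:
  assumes ab: "1 / 2 < a" "a \<le> b" "b < 1" and T: "0 < t0" "t0 \<le> T" "1 \<le> T" and q: "0 \<le> q" "q < 1 / 2"
  obtains C where "0 \<le> C"
    "\<And>H r s. H s \<in> {a..b} \<Longrightarrow> H r \<in> {a..b} \<Longrightarrow> t0 \<le> r \<Longrightarrow> r \<le> s \<Longrightarrow> s \<le> T \<Longrightarrow> s - r \<le> 1 \<Longrightarrow>
      (LINT u:{0..s}|lborel. (K_kernel H s u - K_kernel H r u)\<^sup>2)
      \<le> C * ((s - r) powr (H s - 1 / 2 + q) + \<bar>H s - H r\<bar>)\<^sup>2"
proof -
  obtain c0 M where M: "0 < c0" "0 < M" "\<And>h. h \<in> {a..b} \<Longrightarrow> c0 \<le> c_hurst h \<and> c_hurst h \<le> M"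
    by (rule c_hurst_bounds[OF ab]) blast
  obtain C1 where C1: "0 \<le> C1"
    "\<And>H r s u. H s \<in> {a..b} \<Longrightarrow> H r \<in> {a..b} \<Longrightarrow> 0 < u \<Longrightarrow> u < r \<Longrightarrow> r \<le> s \<Longrightarrow> s \<le> T \<Longrightarrow>
      \<bar>K_kernel H s u - K_kernel H r u\<bar>
      \<le> C1 * ((s - r) powr (H s - 1 / 2 + q) + \<bar>H s - H r\<bar>) * (u powr (- b / 2) * (r - u) powr (- q))"
    using K_kernel_increment_bound[OF ab T(3), of q] q by auto
  define P1 where "P1 = (t0 / 2) powr (- (2 * q))"
  define P2 where "P2 = (t0 / 2) powr (- b)"
  define I1 where "I1 = C1\<^sup>2 * (P1 * (T / (1 - b)) + P2 * (T / (1 - 2 * q)))"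
  define C3 where "C3 = M * (T / t0) / (a - 1 / 2)"
  have P: "0 \<le> P1" "0 \<le> P2" by (auto simp: P1_def P2_def)
  have I1: "0 \<le> I1" using P T q ab by (auto simp: I1_def)
  show ?thesis
  proof (rule that[of "I1 + C3\<^sup>2"])
    show "0 \<le> I1 + C3\<^sup>2" using I1 by simp
    fix H :: "real \<Rightarrow> real" and r s :: real
    assume H: "H s \<in> {a..b}" "H r \<in> {a..b}" and rs: "t0 \<le> r" "r \<le> s" "s \<le> T" "s - r \<le> 1"
    define x where "x = H s - 1 / 2"
    define \<Delta> where "\<Delta> = (s - r) powr (H s - 1 / 2 + q) + \<bar>H s - H r\<bar>"
    have x: "0 < x" "x \<le> 1 / 2" "a - 1 / 2 \<le> x" using H ab by (auto simp: x_def)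
    have left: "set_integrable lborel {0..r} (\<lambda>u. u powr (- b))"
        "(LINT u:{0..r}|lborel. u powr (- b)) = r powr (1 - b) / (1 - b)"
      using set_integral_powr_left[of "1 - b" 0 0 r] ab rs T by auto
    have right: "set_integrable lborel {0..r} (\<lambda>u. (r - u) powr (- (2 * q)))"
        "(LINT u:{0..r}|lborel. (r - u) powr (- (2 * q))) = r powr (1 - 2 * q) / (1 - 2 * q)"
      using set_integral_powr_right[of "1 - 2 * q" 0 r r] q rs T by auto
    define g1 where "g1 u = (C1 * \<Delta>)\<^sup>2 * (P1 * u powr (- b) + P2 * (r - u) powr (- (2 * q)))" for u
    define k where "k = C3\<^sup>2 * (s - r) powr (2 * x)"
    have g1: "set_integrable lborel {0..r} g1"
      unfolding g1_def by (intro set_integrable_mult_right set_integral_add left right)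
    have k: "set_integrable lborel {r..s} (\<lambda>u. k)"
      by (intro borel_integrable_atLeastAtMost') auto
    have K0: "K_kernel H w 0 = 0" for w by (simp add: K_kernel_def)
    have Kr: "K_kernel H r u = 0" if "r \<le> u" for u
      using that H ab rs T by (intro K_kernel_eq_0) auto
    have b1: "(K_kernel H s u - K_kernel H r u)\<^sup>2 \<le> g1 u" if "0 < u" "u < r" for u
    proof -
      have "\<bar>K_kernel H s u - K_kernel H r u\<bar> \<le> C1 * \<Delta> * (u powr (- b / 2) * (r - u) powr (- q))"
        unfolding \<Delta>_def by (intro C1 H that rs)
      then have "\<bar>K_kernel H s u - K_kernel H r u\<bar>\<^sup>2 \<le> (C1 * \<Delta> * (u powr (- b / 2) * (r - u) powr (- q)))\<^sup>2"
        by (intro power_mono) auto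
      also have "\<dots> = (C1 * \<Delta>)\<^sup>2 * (u powr (- b) * (r - u) powr (- (2 * q)))"
        by (simp add: power_mult_distrib powr_power2)
      also have "\<dots> \<le> g1 u"
        unfolding g1_def P1_def P2_def
        using that rs T q ab by (intro mult_left_mono powr_product_singularity) auto
      finally show ?thesis by simp
    qed
    have b2: "(K_kernel H s u - K_kernel H r u)\<^sup>2 \<le> k" if u: "r \<le> u" "u \<le> s" for u
    proof -
      have u0: "0 < u" using that rs T by simp
      have "J_kernel x s u \<le> (s / u) powr x * ((s - u) powr x / x)"
        using that x u0 by (intro J_kernel_upper) auto
      also have "\<dots> \<le> (T / t0) powr 1 * ((s - r) powr x / (a - 1 / 2))"
      proof (intro mult_mono)
        have "(s / u) powr x \<le> (T / t0) powr x"
          using that rs T x u0 by (intro powr_mono2 frac_le) auto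
        also have "\<dots> \<le> (T / t0) powr 1" using T x by (intro powr_mono) auto
        finally show "(s / u) powr x \<le> (T / t0) powr 1" .
        show "(s - u) powr x / x \<le> (s - r) powr x / (a - 1 / 2)"
          using that x ab by (intro frac_le powr_mono2) auto
      qed (use x in auto)
      finally have J: "J_kernel x s u \<le> (T / t0) * ((s - r) powr x / (a - 1 / 2))" using T by simp
      have c: "0 \<le> c_hurst (H s)" "c_hurst (H s) \<le> M" using M(1) M(3)[OF H(1)] by auto
      have "K_kernel H s u = c_hurst (H s) * J_kernel x s u" by (simp add: K_kernel_eq[OF u0] x_def)
      also have "\<dots> \<le> M * ((T / t0) * ((s - r) powr x / (a - 1 / 2)))"
        using M(2) by (intro mult_mono c J J_kernel_nonneg) auto
      finally have "K_kernel H s u \<le> C3 * (s - r) powr x" by (simp add: C3_def)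
      moreover have "0 \<le> K_kernel H s u" using c J_kernel_nonneg by (simp add: K_kernel_eq[OF u0])
      ultimately have "(K_kernel H s u)\<^sup>2 \<le> (C3 * (s - r) powr x)\<^sup>2" by (intro power_mono)
      then show ?thesis by (simp add: Kr[OF u(1)] k_def power_mult_distrib powr_power2)
    qed
    have g1_nonneg: "0 \<le> g1 u" and k_nonneg: "0 \<le> k" for u using P by (auto simp: g1_def k_def)
    have "(LINT u:{0..s}|lborel. (K_kernel H s u - K_kernel H r u)\<^sup>2)
      \<le> (LINT u|lborel. indicator {0..r} u *\<^sub>R g1 u + indicator {r..s} u *\<^sub>R k)"
      unfolding set_lebesgue_integral_def
    proof (rule integral_mono')
      show "integrable lborel (\<lambda>u. indicator {0..r} u *\<^sub>R g1 u + indicator {r..s} u *\<^sub>R k)"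
        using g1 k by (auto simp: set_integrable_def)
      fix u :: real
      show "0 \<le> indicator {0..r} u *\<^sub>R g1 u + indicator {r..s} u *\<^sub>R k"
        using g1_nonneg k_nonneg by simp
      show "indicator {0..s} u *\<^sub>R (K_kernel H s u - K_kernel H r u)\<^sup>2
        \<le> indicator {0..r} u *\<^sub>R g1 u + indicator {r..s} u *\<^sub>R k"
      proof -
        consider "u < 0 \<or> s < u" | "u = 0" | "0 < u" "u < r" | "0 < u" "r \<le> u" "u \<le> s" by linarith
        then show ?thesis
        proof cases
          case 1
          then show ?thesis using g1_nonneg k_nonneg by (auto simp: indicator_def)
        next
          case 2
          then show ?thesis using K0 g1_nonneg k_nonneg by simp
        next
          case 3
          then show ?thesis using b1[of u] rs by simp
        next
          case 4
          then show ?thesis using b2[of u] g1_nonneg[of u] by (simp add: add_increasing)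
        qed
      qed
    qed
    also have "\<dots> = (LINT u:{0..r}|lborel. g1 u) + (LINT u:{r..s}|lborel. k)"
      using g1 k by (simp add: set_lebesgue_integral_def set_integrable_def)
    also have "(LINT u:{r..s}|lborel. k) = k * (s - r)"
      using rs by (simp add: set_lebesgue_integral_def)
    also have "(LINT u:{0..r}|lborel. g1 u)
      = (C1 * \<Delta>)\<^sup>2 * (P1 * (r powr (1 - b) / (1 - b)) + P2 * (r powr (1 - 2 * q) / (1 - 2 * q)))"
      unfolding g1_def set_integral_mult_right
      by (subst set_integral_add) (simp_all add: left right)
    also have "\<dots> \<le> (C1 * \<Delta>)\<^sup>2 * (P1 * (T / (1 - b)) + P2 * (T / (1 - 2 * q)))"
    proof -
      have "r powr e \<le> T" if "0 \<le> e" "e \<le> 1" for e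
      proof -
        have "r powr e \<le> T powr e" using that rs T by (intro powr_mono2) auto
        also have "\<dots> \<le> T powr 1" using that T by (intro powr_mono) auto
        finally show ?thesis using T by simp
      qed
      then show ?thesis using ab q P by (intro mult_left_mono add_mono divide_right_mono) auto
    qed
    also have "\<dots> = I1 * \<Delta>\<^sup>2" by (simp add: I1_def power_mult_distrib mult_ac)
    also have "k * (s - r) \<le> C3\<^sup>2 * \<Delta>\<^sup>2"
    proof -
      have "k * (s - r) = C3\<^sup>2 * (s - r) powr (2 * x + 1)"
        using rs by (cases "s = r") (simp_all add: k_def powr_add)
      \<comment> \<open>Here \<open>s - r \<le> 1\<close> matters: the larger exponent \<open>2 * x + 1\<close> may be lowered to \<open>2 * (x + q)\<close>.\<close>
      also have "\<dots> \<le> C3\<^sup>2 * ((s - r) powr (x + q))\<^sup>2"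
        unfolding powr_power2 using rs q by (intro mult_left_mono powr_mono') auto
      also have "\<dots> \<le> C3\<^sup>2 * \<Delta>\<^sup>2"
        unfolding \<Delta>_def x_def by (intro mult_left_mono power_mono) auto
      finally show ?thesis .
    qed
    finally show "(LINT u:{0..s}|lborel. (K_kernel H s u - K_kernel H r u)\<^sup>2)
      \<le> (I1 + C3\<^sup>2) * ((s - r) powr (H s - 1 / 2 + q) + \<bar>H s - H r\<bar>)\<^sup>2"
      by (simp add: \<Delta>_def distrib_right)
  qed
qed

text \<open>On \<open>{r..s}\<close> the kernel of \<open>r\<close> contributes nothing, and \<open>v / u \<ge> 1\<close> in the density bounds the kernel of \<open>s\<close>
  from below by a multiple of \<open>(s - u) powr (H s - 1 / 2)\<close>.\<close>

lemma K_kernel_increment_L2_lower: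
  assumes ab: "1 / 2 < a" "a \<le> b" "b < 1"
  obtains c where "0 < c"
    "\<And>H r s. H s \<in> {a..b} \<Longrightarrow> H r \<in> {a..b} \<Longrightarrow> 0 < r \<Longrightarrow> r \<le> s \<Longrightarrow>
      c * (s - r) powr (2 * H s) \<le> (LINT u:{0..s}|lborel. (K_kernel H s u - K_kernel H r u)\<^sup>2)"
proof -
  obtain c0 M where M: "0 < c0" "0 < M" "\<And>h. h \<in> {a..b} \<Longrightarrow> c0 \<le> c_hurst h \<and> c_hurst h \<le> M"
    by (rule c_hurst_bounds[OF ab]) blast
  show ?thesis
  proof (rule that[of "c0\<^sup>2 / 2"])
    show "0 < c0\<^sup>2 / 2" using M by simp
    fix H :: "real \<Rightarrow> real" and r s :: real
    assume H: "H s \<in> {a..b}" "H r \<in> {a..b}" and rs: "0 < r" "r \<le> s"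
    define x where "x = H s - 1 / 2"
    have x: "0 < x" "x \<le> 1 / 2" using H ab by (auto simp: x_def)
    have right: "set_integrable lborel {r..s} (\<lambda>u. (s - u) powr (2 * x))"
        "(LINT u:{r..s}|lborel. (s - u) powr (2 * x)) = (s - r) powr (2 * x + 1) / (2 * x + 1)"
      using set_integral_powr_right[of "2 * x + 1" r s s] x rs by auto
    have "c0\<^sup>2 / 2 * (s - r) powr (2 * H s) \<le> c0\<^sup>2 * ((s - r) powr (2 * x + 1) / (2 * x + 1))"
    proof -
      have "2 * H s = 2 * x + 1" by (simp add: x_def)
      then have "c0\<^sup>2 / 2 * (s - r) powr (2 * H s) = c0\<^sup>2 * ((s - r) powr (2 * x + 1) / 2)" by simp
      also have "\<dots> \<le> c0\<^sup>2 * ((s - r) powr (2 * x + 1) / (2 * x + 1))"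
        using x by (intro mult_left_mono divide_left_mono) auto
      finally show ?thesis .
    qed
    also have "\<dots> = (LINT u:{r..s}|lborel. c0\<^sup>2 * (s - u) powr (2 * x))"
      by (simp add: right)
    also have "\<dots> \<le> (LINT u:{0..s}|lborel. (K_kernel H s u - K_kernel H r u)\<^sup>2)"
      unfolding set_lebesgue_integral_def
    proof (rule integral_mono)
      show "integrable lborel (\<lambda>u. indicator {r..s} u *\<^sub>R (c0\<^sup>2 * (s - u) powr (2 * x)))"
        unfolding set_integrable_def[symmetric] by (intro set_integrable_mult_right right)
      show "integrable lborel (\<lambda>u. indicator {0..s} u *\<^sub>R (K_kernel H s u - K_kernel H r u)\<^sup>2)"
        unfolding set_integrable_def[symmetric] using rs by (intro R_kernel_increment(1)[where H = H and s = s and r = r, OF ab H]) auto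
      fix u :: real
      show "indicator {r..s} u *\<^sub>R (c0\<^sup>2 * (s - u) powr (2 * x))
        \<le> indicator {0..s} u *\<^sub>R (K_kernel H s u - K_kernel H r u)\<^sup>2"
      proof (cases "u \<in> {r..s}")
        case u: True
        then have u0: "0 < u" using rs by simp
        have Kr: "K_kernel H r u = 0"
          using u H ab rs by (intro K_kernel_eq_0) auto
        have "(s - u) powr x \<le> (s - u) powr x / x"
          using x divide_left_mono[of x 1 "(s - u) powr x"] by simp
        also have "\<dots> \<le> J_kernel x s u" using x u u0 by (intro J_kernel_lower) auto
        finally have "c0 * (s - u) powr x \<le> c_hurst (H s) * J_kernel x s u"
          using M(1) M(3)[OF H(1)] by (intro mult_mono) auto
        then have "(c0 * (s - u) powr x)\<^sup>2 \<le> (K_kernel H s u)\<^sup>2"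
          using M(1) by (intro power_mono) (auto simp: K_kernel_eq[OF u0] x_def)
        then show ?thesis using u rs by (simp add: Kr power_mult_distrib powr_power2)
      qed simp
    qed
    finally show "c0\<^sup>2 / 2 * (s - r) powr (2 * H s)
      \<le> (LINT u:{0..s}|lborel. (K_kernel H s u - K_kernel H r u)\<^sup>2)" .
  qed
qed

section \<open>The local Hoelder exponent of a function\<close>

text \<open>Every \<open>h \<noteq> 0\<close> near \<open>0\<close> satisfies \<open>\<delta> / 2 ^ Suc n \<le> \<bar>h\<bar> < \<delta> / 2 ^ n\<close> for some \<open>n\<close>; the modulus at
  level \<open>n\<close> is then of order \<open>\<bar>h\<bar> powr \<gamma>'\<close>.\<close>

lemma dyadic_modulus_tendsto:
  fixes f :: "real \<Rightarrow> real"
  assumes \<delta>: "0 < \<delta>" and \<gamma>: "\<gamma> < \<gamma>'" "0 < \<gamma>'" and K: "0 \<le> K"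
    and mod: "\<And>n s. N \<le> n \<Longrightarrow> \<bar>s - t\<bar> < \<delta> / 2 ^ n \<Longrightarrow> \<bar>f s - f t\<bar> \<le> K * (2 powr - \<gamma>') ^ n"
  shows "((\<lambda>h. \<bar>f (t + h) - f t\<bar> / \<bar>h\<bar> powr \<gamma>) \<longlongrightarrow> 0) (at 0 within S)"
proof -
  have bound: "\<bar>f (t + h) - f t\<bar> \<le> K * (2 / \<delta>) powr \<gamma>' * \<bar>h\<bar> powr \<gamma>'" if h: "h \<noteq> 0" "\<bar>h\<bar> < \<delta> / 2 ^ N" for h
  proof -
    define L where "L = log 2 (\<delta> / \<bar>h\<bar>)"
    \<comment> \<open>the largest integer strictly below \<open>L\<close>, as the modulus is assumed on an open interval\<close>
    define n where "n = nat (\<lceil>L\<rceil> - 1)"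
    have p: "2 powr L = \<delta> / \<bar>h\<bar>" using h \<delta> by (simp add: L_def)
    have "2 powr real N < 2 powr L" using h \<delta> unfolding p by (simp add: powr_realpow field_simps)
    then have NL: "real N < L" by simp
    then have "int N < \<lceil>L\<rceil>" by (simp add: less_ceiling_iff)
    then have n: "N \<le> n" "real n = of_int \<lceil>L\<rceil> - 1" by (auto simp: n_def)
    have "real n < L" "L \<le> real n + 1" unfolding n(2) by linarith+
    then have "2 powr real n < 2 powr L" "2 powr L \<le> 2 powr (real n + 1)" by simp_all
    then have hn: "2 ^ n < \<delta> / \<bar>h\<bar>" "\<delta> / \<bar>h\<bar> \<le> 2 * 2 ^ n"
      unfolding p by (simp_all add: powr_realpow powr_add)
    have "\<bar>f (t + h) - f t\<bar> \<le> K * (2 powr - \<gamma>') ^ n"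
    proof (rule mod[OF n(1)])
      show "\<bar>t + h - t\<bar> < \<delta> / 2 ^ n" using hn(1) h by (simp add: field_simps)
    qed
    also have "(2 powr - \<gamma>') ^ n = (1 / 2 ^ n) powr \<gamma>'"
      by (simp add: powr_realpow[symmetric] powr_powr powr_divide powr_minus_divide mult.commute)
    also have "\<dots> \<le> (2 / \<delta> * \<bar>h\<bar>) powr \<gamma>'"
      using hn(2) h \<delta> \<gamma> by (intro powr_mono2) (auto simp: field_simps)
    also have "\<dots> = (2 / \<delta>) powr \<gamma>' * \<bar>h\<bar> powr \<gamma>'"
      using \<delta> by (intro powr_mult)
    finally show ?thesis using K by (simp add: mult_left_mono mult.assoc)
  qed
  show ?thesis
  proof (rule Lim_null_comparison)
    have "\<forall>\<^sub>F h in at 0 within S. h \<noteq> 0 \<and> \<bar>h\<bar> < \<delta> / 2 ^ N"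
      using \<delta> unfolding eventually_at by (intro exI[of _ "\<delta> / 2 ^ N"]) (auto simp: dist_real_def)
    then show "\<forall>\<^sub>F h in at 0 within S. norm (\<bar>f (t + h) - f t\<bar> / \<bar>h\<bar> powr \<gamma>)
        \<le> K * (2 / \<delta>) powr \<gamma>' * \<bar>h\<bar> powr (\<gamma>' - \<gamma>)"
    proof eventually_elim
      case (elim h)
      then have "\<bar>f (t + h) - f t\<bar> / \<bar>h\<bar> powr \<gamma> \<le> K * (2 / \<delta>) powr \<gamma>' * \<bar>h\<bar> powr \<gamma>' / \<bar>h\<bar> powr \<gamma>"
        by (intro divide_right_mono bound) auto
      then show ?case by (simp add: powr_diff)
    qed
    have "((\<lambda>h::real. \<bar>h\<bar>) \<longlongrightarrow> \<bar>0\<bar>) (at 0 within S)" by (intro tendsto_intros)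
    then have "((\<lambda>h::real. \<bar>h\<bar> powr (\<gamma>' - \<gamma>)) \<longlongrightarrow> 0) (at 0 within S)"
      using \<gamma> by (intro tendsto_zero_powrI[where b = "\<gamma>' - \<gamma>"]) auto
    then show "((\<lambda>h. K * (2 / \<delta>) powr \<gamma>' * \<bar>h\<bar> powr (\<gamma>' - \<gamma>)) \<longlongrightarrow> 0) (at 0 within S)"
      by (rule tendsto_mult_right_zero)
  qed
qed

lemma tendsto_holder_quotient_mono:
  fixes f :: "real \<Rightarrow> real"
  assumes lim: "((\<lambda>h. \<bar>f (t + h) - f t\<bar> / \<bar>h\<bar> powr \<gamma>) \<longlongrightarrow> 0) (at 0 within S)" and le: "\<gamma>' \<le> \<gamma>"
  shows "((\<lambda>h. \<bar>f (t + h) - f t\<bar> / \<bar>h\<bar> powr \<gamma>') \<longlongrightarrow> 0) (at 0 within S)"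
proof (rule Lim_null_comparison[OF _ lim])
  have "\<forall>\<^sub>F h in at 0 within S. h \<noteq> 0 \<and> \<bar>h\<bar> < 1"
    unfolding eventually_at by (intro exI[of _ 1]) (auto simp: dist_real_def)
  then show "\<forall>\<^sub>F h in at 0 within S. norm (\<bar>f (t + h) - f t\<bar> / \<bar>h\<bar> powr \<gamma>') \<le> \<bar>f (t + h) - f t\<bar> / \<bar>h\<bar> powr \<gamma>"
  proof eventually_elim
    case (elim h)
    then have "\<bar>h\<bar> powr \<gamma> \<le> \<bar>h\<bar> powr \<gamma>'" using le by (intro powr_mono') auto
    then show ?case using elim by (simp add: divide_left_mono)
  qed
qed

text \<open>The admissible exponents are closed downwards, so countably many of them on either side of \<open>\<eta>\<close> decide the supremum.
  The lower ones are chosen as \<open>\<eta> - \<eta> / (real k + 2)\<close> because these are positive when \<open>\<eta>\<close> is.\<close>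

lemma local_holder_exponent_eqI:
  fixes f :: "real \<Rightarrow> real"
  assumes small: "\<And>k::nat. ((\<lambda>h. \<bar>f (t + h) - f t\<bar> / \<bar>h\<bar> powr (\<eta> - \<eta> / (real k + 2))) \<longlongrightarrow> 0) (at 0 within {h. 0 \<le> t + h})"
    and large: "\<And>k::nat. \<not> ((\<lambda>h. \<bar>f (t + h) - f t\<bar> / \<bar>h\<bar> powr (\<eta> + 1 / (real k + 1))) \<longlongrightarrow> 0) (at 0 within {h. 0 \<le> t + h})"
  shows "local_holder_exponent f t = ereal \<eta>"
proof -
  define A where "A = {\<alpha>. ((\<lambda>h. \<bar>f (t + h) - f t\<bar> / \<bar>h\<bar> powr \<alpha>) \<longlongrightarrow> 0) (at 0 within {h. 0 \<le> t + h})}"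
  have "Sup (ereal ` A) \<le> ereal \<eta>"
  proof (intro Sup_least)
    fix y assume "y \<in> ereal ` A"
    then obtain \<gamma> where \<gamma>: "y = ereal \<gamma>" "\<gamma> \<in> A" by auto
    have "\<gamma> \<le> \<eta>"
    proof (rule ccontr)
      assume "\<not> \<gamma> \<le> \<eta>"
      then obtain k where "1 / real (Suc k) < \<gamma> - \<eta>" using nat_approx_posE[of "\<gamma> - \<eta>"] by auto
      then have "\<eta> + 1 / (real k + 1) \<le> \<gamma>" by (simp add: add.commute)
      then show False using large[of k] tendsto_holder_quotient_mono[of f t \<gamma>] \<gamma>(2) unfolding A_def by blast
    qed
    then show "y \<le> ereal \<eta>" using \<gamma> by simp
  qed
  moreover have "ereal \<eta> \<le> Sup (ereal ` A)"
  proof (rule LIMSEQ_le_const2)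
    have "(\<lambda>k. \<eta> - \<eta> / (real k + 2)) \<longlonglongrightarrow> \<eta> - 0"
      by (intro tendsto_intros tendsto_divide_0[OF tendsto_const] filterlim_at_top_imp_at_infinity)
        (rule filterlim_at_top_mono[OF filterlim_real_sequentially], simp)
    then show "(\<lambda>k. ereal (\<eta> - \<eta> / (real k + 2))) \<longlonglongrightarrow> ereal \<eta>" by simp
    show "\<exists>N. \<forall>k\<ge>N. ereal (\<eta> - \<eta> / (real k + 2)) \<le> Sup (ereal ` A)"
      using small by (auto intro!: Sup_upper simp: A_def)
  qed
  ultimately show ?thesis unfolding local_holder_exponent_def A_def by (rule antisym)
qed

section \<open>Local regularity of fractional Brownian motion with variable Hurst parameter\<close>

text \<open>The increment is a linear combination of two values of the process, hence Gaussian.\<close>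

lemma fBMvH_increment:
  assumes X: "fBMvH M H X" and ab: "1 / 2 < a" "a \<le> b" "b < 1"
    and H: "\<And>t. 0 \<le> t \<Longrightarrow> H t \<in> {a..b}" and rs: "0 \<le> r" "0 \<le> s"
  shows "gaussian_rv M (\<lambda>\<omega>. X s \<omega> - X r \<omega>)"
    and "(LINT \<omega>|M. X s \<omega> - X r \<omega>) = 0"
    and "r \<le> s \<Longrightarrow> (LINT \<omega>|M. (X s \<omega> - X r \<omega>)\<^sup>2) =
      (LINT u:{0..s}|lborel. (K_kernel H s u - K_kernel H r u)\<^sup>2)"
proof -
  have M: "prob_space M" "gaussian_process M {0..} X" and mean: "\<And>t. t \<in> {0..} \<Longrightarrow> (LINT \<omega>|M. X t \<omega>) = 0"
    and cov: "\<And>t s. 0 \<le> t \<Longrightarrow> 0 \<le> s \<Longrightarrow> covariance M (X t) (X s) = R_kernel H t s"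
    using X by (auto simp: fBMvH_def)
  have r: "r \<in> {0..}" and s: "s \<in> {0..}" using rs by auto
  note inc = centred_gaussian_process_increment[OF M mean s r]
  show "gaussian_rv M (\<lambda>\<omega>. X s \<omega> - X r \<omega>)" by (rule inc(1))
  show "(LINT \<omega>|M. X s \<omega> - X r \<omega>) = 0" by (rule inc(2))
  show "(LINT \<omega>|M. (X s \<omega> - X r \<omega>)\<^sup>2) =
      (LINT u:{0..s}|lborel. (K_kernel H s u - K_kernel H r u)\<^sup>2)" if "r \<le> s"
  proof -
    have "(LINT \<omega>|M. (X s \<omega> - X r \<omega>)\<^sup>2) =
      covariance M (X s) (X s) - 2 * covariance M (X s) (X r) + covariance M (X r) (X r)"
      by (rule inc(3))
    also have "\<dots> = R_kernel H s s - 2 * R_kernel H s r + R_kernel H r r" using cov rs by simp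
    also have "\<dots> = (LINT u:{0..s}|lborel. (K_kernel H s u - K_kernel H r u)\<^sup>2)"
      by (rule R_kernel_increment(2)[where H = H and s = s and r = r, OF ab H[OF rs(2)] H[OF rs(1)] rs(1) that])
    finally show ?thesis .
  qed
qed

text \<open>By continuity of \<open>H\<close>, half of the gap between \<open>\<beta>\<close> and \<open>H t\<close> pays for replacing \<open>H s\<close> by \<open>H t\<close>; the other half pays for the
  loss in the time increment of the kernel. The term \<open>\<bar>H s - H r\<bar>\<close> is of order \<open>\<bar>s - r\<bar> powr \<alpha>\<close>, and \<open>\<beta> \<le> \<alpha>\<close>.\<close>

lemma fBMvH_variance_upper:
  assumes X: "fBMvH M H X" and ab: "1 / 2 < a" "a \<le> b" "b < 1"
    and H: "\<And>t. 0 \<le> t \<Longrightarrow> H t \<in> {a..b}"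
    and hol: "\<And>s t. 0 \<le> s \<Longrightarrow> 0 \<le> t \<Longrightarrow> \<bar>H s - H t\<bar> \<le> L * \<bar>s - t\<bar> powr \<alpha>" and L: "0 \<le> L"
    and t: "0 < t" and \<beta>: "0 < \<beta>" "\<beta> < H t" "\<beta> \<le> \<alpha>"
  obtains \<delta> V where "0 < \<delta>" "\<delta> < t" "0 \<le> V"
    "\<And>r s. r \<in> {t - \<delta>..t + \<delta>} \<Longrightarrow> s \<in> {t - \<delta>..t + \<delta>} \<Longrightarrow>
      (LINT \<omega>|M. (X s \<omega> - X r \<omega>)\<^sup>2) \<le> V * (\<bar>s - r\<bar> powr \<beta>)\<^sup>2"
proof -
  define e where "e = (H t - \<beta>) / 2"
  have e: "0 < e" "e < 1 / 2" using \<beta> H[of t] t ab by (auto simp: e_def)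
  have "((\<lambda>\<delta>. L * \<delta> powr \<alpha>) \<longlongrightarrow> L * 0) (at_right 0)"
    using \<beta> by (intro tendsto_intros tendsto_zero_powrI[where b = \<alpha>])
      (auto simp: eventually_at_right_less intro: eventually_mono[OF eventually_at_right_less])
  then have "\<forall>\<^sub>F \<delta> in at_right 0. L * \<delta> powr \<alpha> < e"
    using e by (intro order_tendstoD) auto
  then obtain \<delta>0 where \<delta>0: "0 < \<delta>0" "\<And>\<delta>. 0 < \<delta> \<Longrightarrow> \<delta> < \<delta>0 \<Longrightarrow> L * \<delta> powr \<alpha> < e"
    unfolding eventually_at_right_field by auto
  define \<delta> where "\<delta> = min (\<delta>0 / 2) (min (t / 2) (1 / 2))"
  have \<delta>: "0 < \<delta>" "\<delta> < \<delta>0" "\<delta> \<le> t / 2" "\<delta> \<le> 1 / 2" using \<delta>0 t by (auto simp: \<delta>_def)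
  have He: "H t - e \<le> H s" if "s \<in> {t - \<delta>..t + \<delta>}" for s
  proof -
    have "\<bar>H s - H t\<bar> \<le> L * \<bar>s - t\<bar> powr \<alpha>" using that \<delta> t by (intro hol) auto
    also have "\<dots> \<le> L * \<delta> powr \<alpha>" using that \<beta> L by (intro mult_left_mono powr_mono2) auto
    also have "\<dots> < e" using \<delta> by (intro \<delta>0) auto
    finally show ?thesis by linarith
  qed
  define q where "q = 1 / 2 - e"
  have q: "0 \<le> q" "q < 1 / 2" using e by (auto simp: q_def)
  obtain C where C: "0 \<le> C"
    "\<And>H r s. H s \<in> {a..b} \<Longrightarrow> H r \<in> {a..b} \<Longrightarrow> t / 2 \<le> r \<Longrightarrow> r \<le> s \<Longrightarrow> s \<le> t + 1 \<Longrightarrow> s - r \<le> 1 \<Longrightarrow>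
      (LINT u:{0..s}|lborel. (K_kernel H s u - K_kernel H r u)\<^sup>2)
      \<le> C * ((s - r) powr (H s - 1 / 2 + q) + \<bar>H s - H r\<bar>)\<^sup>2"
    using K_kernel_increment_L2_upper[OF ab, of "t / 2" "t + 1" q] t q by auto
  show ?thesis
  proof (rule that[OF \<delta>(1), of "C * (1 + L)\<^sup>2"])
    show "\<delta> < t" using \<delta> t by simp
    show "0 \<le> C * (1 + L)\<^sup>2" using C by simp
    have ordered: "(LINT \<omega>|M. (X s \<omega> - X r \<omega>)\<^sup>2) \<le> C * (1 + L)\<^sup>2 * (\<bar>s - r\<bar> powr \<beta>)\<^sup>2"
      if r: "r \<in> {t - \<delta>..t + \<delta>}" and s: "s \<in> {t - \<delta>..t + \<delta>}" and "r \<le> s" for r s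
    proof -
      have rs: "0 \<le> r" "0 \<le> s" "t / 2 \<le> r" "s \<le> t + 1" "s - r \<le> 1" using r s \<delta> t by auto
      have "(LINT \<omega>|M. (X s \<omega> - X r \<omega>)\<^sup>2) = (LINT u:{0..s}|lborel. (K_kernel H s u - K_kernel H r u)\<^sup>2)"
        using fBMvH_increment(3)[OF X ab H] rs \<open>r \<le> s\<close> by simp
      also have "\<dots> \<le> C * ((s - r) powr (H s - 1 / 2 + q) + \<bar>H s - H r\<bar>)\<^sup>2"
        using rs \<open>r \<le> s\<close> by (intro C H) auto
      also have "\<dots> \<le> C * ((1 + L) * \<bar>s - r\<bar> powr \<beta>)\<^sup>2"
      proof (intro mult_left_mono power_mono C)
        have "(s - r) powr (H s - 1 / 2 + q) \<le> (s - r) powr \<beta>"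
          using He[OF s] rs \<open>r \<le> s\<close> by (intro powr_mono') (auto simp: q_def e_def field_simps)
        moreover have "\<bar>H s - H r\<bar> \<le> L * (s - r) powr \<beta>"
        proof -
          have "\<bar>H s - H r\<bar> \<le> L * \<bar>s - r\<bar> powr \<alpha>" using rs by (intro hol) auto
          also have "\<dots> \<le> L * \<bar>s - r\<bar> powr \<beta>"
            using rs \<open>r \<le> s\<close> \<beta> L by (intro mult_left_mono powr_mono') auto
          finally show ?thesis using \<open>r \<le> s\<close> by simp
        qed
        ultimately show "(s - r) powr (H s - 1 / 2 + q) + \<bar>H s - H r\<bar> \<le> (1 + L) * \<bar>s - r\<bar> powr \<beta>"
          using \<open>r \<le> s\<close> by (simp add: distrib_right)
      qed auto
      finally show ?thesis by (simp add: power_mult_distrib mult.assoc)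
    qed
    fix r s assume "r \<in> {t - \<delta>..t + \<delta>}" "s \<in> {t - \<delta>..t + \<delta>}"
    then show "(LINT \<omega>|M. (X s \<omega> - X r \<omega>)\<^sup>2) \<le> C * (1 + L)\<^sup>2 * (\<bar>s - r\<bar> powr \<beta>)\<^sup>2"
      using ordered[of r s] ordered[of s r] by (cases "r \<le> s") (auto simp: power2_commute abs_minus_commute)
  qed
qed

text \<open>Chaining gives the modulus on the separating set. Separability is applied to each path with a closed
  interval \<open>A\<close> centred at the random point \<open>X t \<omega>\<close>: this is legitimate because the exceptional null
  set is the same for all \<open>A\<close> and \<open>I\<close>.\<close>

lemma fBMvH_holder_below:
  assumes X: "fBMvH M H X" and sep: "separable_process M X" and ab: "1 / 2 < a" "a \<le> b" "b < 1"
    and H: "\<And>t. 0 \<le> t \<Longrightarrow> H t \<in> {a..b}"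
    and hol: "\<And>s t. 0 \<le> s \<Longrightarrow> 0 \<le> t \<Longrightarrow> \<bar>H s - H t\<bar> \<le> L * \<bar>s - t\<bar> powr \<alpha>" and L: "0 \<le> L"
    and t: "0 < t" and \<alpha>: "H t < \<alpha>" and \<gamma>: "0 < \<gamma>" "\<gamma> < H t"
  shows "AE \<omega> in M. ((\<lambda>h. \<bar>X (t + h) \<omega> - X t \<omega>\<bar> / \<bar>h\<bar> powr \<gamma>) \<longlongrightarrow> 0) (at 0 within {h. 0 \<le> t + h})"
proof -
  \<comment> \<open>Two intermediate exponents: variances decay with \<open>\<beta>\<close>, the chaining modulus with \<open>\<gamma>' < \<beta>\<close>, and the quotient is taken with \<open>\<gamma> < \<gamma>'\<close>.\<close>
  define \<gamma>' where "\<gamma>' = (2 * \<gamma> + H t) / 3"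
  define \<beta> where "\<beta> = (\<gamma> + 2 * H t) / 3"
  have ord: "\<gamma> < \<gamma>'" "0 < \<gamma>'" "\<gamma>' < \<beta>" "0 < \<beta>" "\<beta> < H t" "\<beta> \<le> \<alpha>"
    using \<gamma> \<alpha> by (auto simp: \<gamma>'_def \<beta>_def)
  obtain \<delta> V where \<delta>: "0 < \<delta>" "\<delta> < t" and V: "0 \<le> V"
    "\<And>r s. r \<in> {t - \<delta>..t + \<delta>} \<Longrightarrow> s \<in> {t - \<delta>..t + \<delta>} \<Longrightarrow>
      (LINT \<omega>|M. (X s \<omega> - X r \<omega>)\<^sup>2) \<le> V * (\<bar>s - r\<bar> powr \<beta>)\<^sup>2"
    using fBMvH_variance_upper[OF X ab H hol L t ord(4,5,6)] by auto
  have M: "prob_space M" using X by (simp add: fBMvH_def)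
  define \<rho> where "\<rho> = 2 powr (- \<gamma>')"
  have \<rho>: "0 < \<rho>" "\<rho> < 1" using ord powr_less_mono[of "- \<gamma>'" 0 2] by (auto simp: \<rho>_def)
  define x where "x = 2 powr (- \<beta>) / \<rho>"
  have x: "0 \<le> x" "x < 1" using ord powr_less_mono[of "\<gamma>' - \<beta>" 0 2]
    by (auto simp: x_def \<rho>_def powr_diff[symmetric])
  obtain k where k: "x ^ k < 1 / 2" using real_arch_pow_inv[of "1 / 2" x] x by auto
  have p: "2 * (2 powr (- \<beta>) / \<rho>) ^ (2 * k) < 1"
    using k power_decreasing[of k "2 * k" x] x unfolding x_def[symmetric] by simp
  define C where "C = fact (2 * k) / (2 ^ k * fact k) * V ^ k"
  have C: "0 \<le> C" using V by (simp add: C_def)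
  obtain D N where D: "countable D" and N: "N \<in> null_sets M"
    and sepDN: "\<forall>A I. closed A \<and> open I \<and> is_interval I \<longrightarrow>
      ({\<omega> \<in> space M. \<forall>t\<in>I \<inter> D. X t \<omega> \<in> A} - {\<omega> \<in> space M. \<forall>t\<in>I \<inter> {0..}. X t \<omega> \<in> A}) \<union>
      ({\<omega> \<in> space M. \<forall>t\<in>I \<inter> {0..}. X t \<omega> \<in> A} - {\<omega> \<in> space M. \<forall>t\<in>I \<inter> D. X t \<omega> \<in> A}) \<subseteq> N"
    using sep unfolding separable_process_def Let_def by (elim exE conjE) (rule that)
  have DN: "\<forall>r\<in>I \<inter> {0..}. X r \<omega> \<in> A"
    if "closed A" "open I" "is_interval I" "\<omega> \<in> space M" "\<omega> \<notin> N" "\<forall>r\<in>I \<inter> D. X r \<omega> \<in> A" for A I \<omega>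
  proof (rule ccontr)
    assume "\<not> (\<forall>r\<in>I \<inter> {0..}. X r \<omega> \<in> A)"
    then have "\<omega> \<in> {\<omega> \<in> space M. \<forall>t\<in>I \<inter> D. X t \<omega> \<in> A} - {\<omega> \<in> space M. \<forall>t\<in>I \<inter> {0..}. X t \<omega> \<in> A}"
      using that by simp
    then have "\<omega> \<in> N" using sepDN[rule_format, of A I] that(1-3) by (meson UnI1 subsetD)
    then show False using that(5) by simp
  qed
  have "AE \<omega> in M. \<exists>n0. \<forall>n\<ge>n0. \<forall>s\<in>D. \<bar>s - t\<bar> < \<delta> / 2 ^ n \<longrightarrow> \<bar>X s \<omega> - X t \<omega>\<bar> \<le> \<rho> ^ n / (1 - \<rho>)"
  proof (rule local_modulus_on_countable_set[OF M _ _ \<delta>(1) ord(4) C \<rho> p D])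
    show "X s \<in> borel_measurable M" if "s \<in> {t - \<delta>..t + \<delta>}" for s
    proof -
      have "gaussian_process M {0..} X" using X by (simp add: fBMvH_def)
      moreover have "s \<in> {0..}" using that \<delta> by auto
      ultimately have "gaussian_rv M (X s)" by (rule gaussian_process_component)
      then show ?thesis by (simp add: gaussian_rv_def)
    qed
    fix r s \<epsilon> :: real
    assume rs: "r \<in> {t - \<delta>..t + \<delta>}" "s \<in> {t - \<delta>..t + \<delta>}" and \<epsilon>: "0 < \<epsilon>"
    then have rs0: "0 \<le> r" "0 \<le> s" using \<delta> by auto
    have "measure M {\<omega> \<in> space M. \<epsilon> < \<bar>X s \<omega> - X r \<omega>\<bar>}
      \<le> fact (2 * k) / (2 ^ k * fact k) * (V * (\<bar>s - r\<bar> powr \<beta>)\<^sup>2 / \<epsilon>\<^sup>2) ^ k"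
      by (intro gaussian_rv_tail M fBMvH_increment[OF X ab H] rs0 V rs \<epsilon>)
    also have "\<dots> = C * (\<bar>s - r\<bar> powr \<beta> / \<epsilon>) ^ (2 * k)"
      by (simp add: C_def power_mult power_mult_distrib power_divide)
    finally show "measure M {\<omega> \<in> space M. \<epsilon> < \<bar>X s \<omega> - X r \<omega>\<bar>} \<le> C * (\<bar>s - r\<bar> powr \<beta> / \<epsilon>) ^ (2 * k)" .
  qed
  with AE_not_in[OF N] AE_space show ?thesis
  proof eventually_elim
    case (elim \<omega>)
    from elim(3) obtain n0 where n0: "\<And>n s. n0 \<le> n \<Longrightarrow> s \<in> D \<Longrightarrow> \<bar>s - t\<bar> < \<delta> / 2 ^ n \<Longrightarrow>
      \<bar>X s \<omega> - X t \<omega>\<bar> \<le> \<rho> ^ n / (1 - \<rho>)" by blast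
    show ?case
    proof (rule dyadic_modulus_tendsto[OF \<delta>(1) ord(1,2)])
      show "0 \<le> 1 / (1 - \<rho>)" using \<rho> by simp
      fix n s assume n: "n0 \<le> n" and s: "\<bar>s - t\<bar> < \<delta> / 2 ^ n"
      define I where "I = {t - \<delta> / 2 ^ n<..<t + \<delta> / 2 ^ n}"
      define A where "A = {X t \<omega> - \<rho> ^ n / (1 - \<rho>)..X t \<omega> + \<rho> ^ n / (1 - \<rho>)}"
      have "X r \<omega> \<in> A" if "r \<in> I \<inter> D" for r
        using n0[OF n, of r] that by (auto simp: I_def A_def abs_le_iff abs_less_iff)
      moreover have "is_interval I" unfolding I_def by (rule is_interval_oo)
      moreover have "closed A" "open I" by (auto simp: A_def I_def)
      ultimately have "\<forall>r\<in>I \<inter> {0..}. X r \<omega> \<in> A" using elim(1,2) by (intro DN) auto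
      moreover have "s \<in> I \<inter> {0..}"
      proof -
        have "\<delta> / 2 ^ n \<le> \<delta> / 1" using \<delta> by (intro divide_left_mono) auto
        then show ?thesis using s \<delta> by (auto simp: I_def abs_less_iff)
      qed
      ultimately have "X s \<omega> \<in> A" by blast
      then show "\<bar>X s \<omega> - X t \<omega>\<bar> \<le> 1 / (1 - \<rho>) * (2 powr - \<gamma>') ^ n"
        by (auto simp: A_def \<rho>_def abs_le_iff)
    qed
  qed
qed

text \<open>Along \<open>s = t + 1 / 2 ^ n\<close> the standard deviation of the increment is eventually at least of order \<open>(1 / 2 ^ n) powr \<eta>\<close>
  for some \<open>\<eta> < \<gamma>\<close>, so the events \<open>\<bar>X s - X t\<bar> \<le> (1 / 2 ^ n) powr \<gamma>\<close> have geometrically decaying probabilities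
  and only finitely many of them occur.\<close>

lemma fBMvH_holder_above:
  assumes X: "fBMvH M H X" and ab: "1 / 2 < a" "a \<le> b" "b < 1"
    and H: "\<And>t. 0 \<le> t \<Longrightarrow> H t \<in> {a..b}"
    and cont: "(\<lambda>n. H (t + 1 / 2 ^ n)) \<longlonglongrightarrow> H t"
    and t: "0 < t" and \<gamma>: "H t < \<gamma>"
  shows "AE \<omega> in M. \<not> ((\<lambda>h. \<bar>X (t + h) \<omega> - X t \<omega>\<bar> / \<bar>h\<bar> powr \<gamma>) \<longlongrightarrow> 0) (at 0 within {h. 0 \<le> t + h})"
proof -
  have "prob_space M" using X by (simp add: fBMvH_def)
  then interpret prob_space M .
  obtain c where c: "0 < c"
    "\<And>H r s. H s \<in> {a..b} \<Longrightarrow> H r \<in> {a..b} \<Longrightarrow> 0 < r \<Longrightarrow> r \<le> s \<Longrightarrow>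
      c * (s - r) powr (2 * H s) \<le> (LINT u:{0..s}|lborel. (K_kernel H s u - K_kernel H r u)\<^sup>2)"
    by (rule K_kernel_increment_L2_lower[OF ab]) blast
  define \<eta> where "\<eta> = (\<gamma> + H t) / 2"
  have \<eta>: "H t < \<eta>" "\<eta> < \<gamma>" using \<gamma> by (auto simp: \<eta>_def)
  have "\<forall>\<^sub>F n in sequentially. H (t + 1 / 2 ^ n) < \<eta>" using cont \<eta> by (intro order_tendstoD)
  then obtain N where N: "\<And>n. N \<le> n \<Longrightarrow> H (t + 1 / 2 ^ n) < \<eta>" by (auto simp: eventually_sequentially)
  define d where "d n = (1::real) / 2 ^ n" for n :: nat
  have d: "0 < d n" "d n \<le> 1" for n by (auto simp: d_def)
  have dpow: "d n powr e = (2 powr - e) ^ n" for n and e :: real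
    by (simp add: d_def powr_realpow[symmetric] powr_powr powr_divide powr_minus_divide mult.commute)
  define E where "E n = {\<omega> \<in> space M. \<bar>X (t + d n) \<omega> - X t \<omega>\<bar> \<le> d n powr \<gamma>}" for n
  have gr: "gaussian_rv M (\<lambda>\<omega>. X (t + d n) \<omega> - X t \<omega>)" "(LINT \<omega>|M. X (t + d n) \<omega> - X t \<omega>) = 0" for n
    using fBMvH_increment(1,2)[OF X ab H, of t "t + d n"] t d[of n] by auto
  have E_meas: "E n \<in> events" for n
  proof -
    have [measurable]: "(\<lambda>\<omega>. X (t + d n) \<omega> - X t \<omega>) \<in> borel_measurable M" using gr(1) by (simp add: gaussian_rv_def)
    show ?thesis unfolding E_def by measurable
  qed
  have "measure M (E n) \<le> 1 / sqrt c * (2 powr - (\<gamma> - \<eta>)) ^ n" if n: "N \<le> n" for n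
  proof -
    have "c * d n powr (2 * \<eta>) \<le> c * d n powr (2 * H (t + d n))"
      using c(1) N[OF n] d[of n] by (intro mult_left_mono powr_mono') (auto simp: d_def)
    also have "\<dots> \<le> (LINT u:{0..t + d n}|lborel. (K_kernel H (t + d n) u - K_kernel H t u)\<^sup>2)"
      using c(2)[of H "t + d n" t] H[of t] H[of "t + d n"] t d[of n] by simp
    also have "\<dots> = (LINT \<omega>|M. (X (t + d n) \<omega> - X t \<omega>)\<^sup>2)"
      using fBMvH_increment(3)[OF X ab H, of t "t + d n"] t d[of n] by simp
    finally have "measure M (E n) \<le> d n powr \<gamma> / sqrt (c * d n powr (2 * \<eta>))"
      unfolding E_def using c(1) d[of n]
      by (intro gaussian_rv_small_ball gr prob_space_axioms) auto
    also have "sqrt (c * d n powr (2 * \<eta>)) = sqrt c * d n powr \<eta>"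
      by (simp add: real_sqrt_mult powr_power2[symmetric])
    also have "d n powr \<gamma> / (sqrt c * d n powr \<eta>) = 1 / sqrt c * d n powr (\<gamma> - \<eta>)"
      by (simp add: powr_diff)
    finally show ?thesis unfolding dpow .
  qed
  then have "norm (measure M (E n)) \<le> 1 / sqrt c * (2 powr - (\<gamma> - \<eta>)) ^ n" if "N \<le> n" for n
    using that by simp
  moreover have "summable (\<lambda>n. 1 / sqrt c * (2 powr - (\<gamma> - \<eta>)) ^ n)"
    using \<eta> powr_less_mono[of "- (\<gamma> - \<eta>)" 0 2] by (intro summable_mult summable_geometric) auto
  ultimately have "summable (\<lambda>n. measure M (E n))" by (rule summable_comparison_test'[rotated])
  then have "AE \<omega> in M. \<forall>\<^sub>F n in sequentially. \<omega> \<in> space M - E n"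
    by (intro borel_cantelli_AE1 E_meas) (auto simp: emeasure_eq_measure)
  then show ?thesis
  proof eventually_elim
    case (elim \<omega>)
    show ?case
    proof
      assume lim: "((\<lambda>h. \<bar>X (t + h) \<omega> - X t \<omega>\<bar> / \<bar>h\<bar> powr \<gamma>) \<longlongrightarrow> 0) (at 0 within {h. 0 \<le> t + h})"
      have "d \<longlonglongrightarrow> 0" unfolding d_def by (intro LIMSEQ_divide_realpow_zero) simp
      then have "filterlim d (at 0 within {h. 0 \<le> t + h}) sequentially"
        unfolding filterlim_at using d(1) t by (auto intro!: always_eventually simp: less_imp_neq[symmetric] less_imp_le)
      from filterlim_compose[OF lim this]
      have "\<forall>\<^sub>F n in sequentially. \<bar>X (t + d n) \<omega> - X t \<omega>\<bar> / \<bar>d n\<bar> powr \<gamma> < 1"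
        by (intro order_tendstoD) auto
      with elim have "\<forall>\<^sub>F n in sequentially. False"
      proof eventually_elim
        case (elim n)
        then have "d n powr \<gamma> < \<bar>X (t + d n) \<omega> - X t \<omega>\<bar>" by (auto simp: E_def)
        with elim(2) d(1)[of n] show False by (simp add: field_simps)
      qed
      then show False by simp
    qed
  qed
qed

theorem corollary3p3p5:
  fixes a b \<alpha> :: real
    and H :: "real \<Rightarrow> real"
    and M :: "'a measure"
    and X :: "real \<Rightarrow> 'a \<Rightarrow> real"
  assumes "1 / 2 < a" and "a \<le> b" and "b < 1"
    and "\<And>t. 0 \<le> t \<Longrightarrow> H t \<in> {a..b}"
    and "holder_continuous_on \<alpha> {0..} H"
    and "\<alpha> \<le> 1" and "(SUP t\<in>{0..}. H t) < \<alpha>"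
    and "fBMvH M H X"
    and "separable_process M X"
  shows "\<forall>t>0. AE \<omega> in M. local_holder_exponent (\<lambda>s. X s \<omega>) t = ereal (H t)"
proof (intro allI impI)
  fix t :: real assume t: "0 < t"
  note ab = assms(1-3)
  obtain L0 where L0: "\<And>s t. 0 \<le> s \<Longrightarrow> 0 \<le> t \<Longrightarrow> \<bar>H s - H t\<bar> \<le> L0 * \<bar>s - t\<bar> powr \<alpha>"
    using assms(5) unfolding holder_continuous_on_def by auto
  define L where "L = max L0 0"
  have L: "0 \<le> L" by (simp add: L_def)
  have hol: "\<bar>H s - H t\<bar> \<le> L * \<bar>s - t\<bar> powr \<alpha>" if "0 \<le> s" "0 \<le> t" for s t
  proof -
    have "L0 * \<bar>s - t\<bar> powr \<alpha> \<le> L * \<bar>s - t\<bar> powr \<alpha>" by (intro mult_right_mono) (auto simp: L_def)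
    then show ?thesis using L0[OF that] by linarith
  qed
  have "H t \<le> (SUP t\<in>{0..}. H t)"
    using assms(4) t by (intro cSUP_upper) (auto intro!: bdd_aboveI[of _ b])
  then have \<alpha>: "H t < \<alpha>" using assms(7) by simp
  have Ht: "0 < H t" using assms(4)[of t] t ab by auto
  have cont: "(\<lambda>n. H (t + 1 / 2 ^ n)) \<longlonglongrightarrow> H t"
  proof (rule LIM_zero_cancel, rule Lim_null_comparison)
    show "\<forall>\<^sub>F n in sequentially. norm (H (t + 1 / 2 ^ n) - H t) \<le> L * (1 / 2 ^ n) powr \<alpha>"
    proof (intro always_eventually allI)
      fix n :: nat
      show "norm (H (t + 1 / 2 ^ n) - H t) \<le> L * (1 / 2 ^ n) powr \<alpha>"
        using hol[of "t + 1 / 2 ^ n" t] t by simp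
    qed
    have "(\<lambda>n. (1 / 2 ^ n :: real) powr \<alpha>) \<longlonglongrightarrow> 0"
      using \<alpha> Ht by (intro tendsto_zero_powrI[where b = \<alpha>] LIMSEQ_divide_realpow_zero) auto
    then show "(\<lambda>n. L * (1 / 2 ^ n) powr \<alpha>) \<longlonglongrightarrow> 0" by (rule tendsto_mult_right_zero)
  qed
  have "AE \<omega> in M. \<forall>k::nat. ((\<lambda>h. \<bar>X (t + h) \<omega> - X t \<omega>\<bar> / \<bar>h\<bar> powr (H t - H t / (real k + 2))) \<longlongrightarrow> 0)
      (at 0 within {h. 0 \<le> t + h})"
    unfolding AE_all_countable
    by (intro allI fBMvH_holder_below[OF assms(8,9) ab assms(4) hol L t \<alpha>])
       (use Ht in \<open>auto simp: field_simps intro!: add_pos_nonneg\<close>)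
  moreover have "AE \<omega> in M. \<forall>k::nat. \<not> ((\<lambda>h. \<bar>X (t + h) \<omega> - X t \<omega>\<bar> / \<bar>h\<bar> powr (H t + 1 / (real k + 1))) \<longlongrightarrow> 0)
      (at 0 within {h. 0 \<le> t + h})"
    unfolding AE_all_countable
    by (intro allI fBMvH_holder_above[OF assms(8) ab assms(4) cont t]) auto
  ultimately show "AE \<omega> in M. local_holder_exponent (\<lambda>s. X s \<omega>) t = ereal (H t)"
    by eventually_elim (intro local_holder_exponent_eqI, auto)
qed

end
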